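(* Let $d\ge1$. Suppose $f$ and $g$ are measurable real-valued functions on a measurable set $R\subset\mathbb{R}^{d}$ which contains $\mathbf{0}$ as an interior point. Suppose that $f$ attains its unique minimum value of $0$ at $\mathbf{0}\in R$ and is otherwise bounded away from zero (for every $\delta>0$, $\inf\{f(\mathbf{x}):\mathbf{x}\in R,\ |\mathbf{x}|\ge\delta\}>0$), and that there are a positive integer $N$ and 1. $N+1$ continuous functions $f_{j}(\Omega)$, $j=0,\dots,N$, on $S^{d-1}$ with $f_{0}(\Omega)>0$ such that for some real number $\nu>0$ $$f(\rho,\Omega)=\rho^{\nu}\sum_{j=0}^{N}f_{j}(\Omega)\rho^{j}+o(\rho^{N+\nu})\quad\text{as }\rho\rightarrow0,$$ 2. $N+1$ functions $g_{j}(\Omega)$, $j=0,\dots,N$, on $S^{d-1}$ such that for some real number $\lambda>0$ $$g(\rho,\Omega)=\rho^{\lambda-d}\sum_{j=0}^{N}g_{j}(\Omega)\rho^{j}+o(\rho^{N+\lambda-d})\quad\text{as }\rho\rightarrow0.$$ If there exists $k_{0}>0$ such that $\int_{R}e^{-k_{0}f}g\,d^{d}\mathbf{x}$ converges, then there exists an asymptotic expansion $$\int_{R}e^{-kf}g\,d^{d}\mathbf{x}=\sum_{j=0}^{N}\zeta_{j}k^{-(j+\lambda)/\nu}+o\left(k^{-(N+\lambda)/\nu}\right),\qquad k\rightarrow\infty,$$ where the coefficients are given by $$\zeta_{j}=\frac{1}{\nu}\Gamma\left(\frac{j+\lambda}{\nu}\right)\int_{S^{d-1}}\left[f_{0}(\Omega)^{-(j+\lambda)/\nu}\sum_{m=0}^{j}g_{j-m}(\Omega)\sum_{r=1}^{m}\binom{-\frac{j+\lambda}{\nu}}{r}\frac{f_{m}^{(r)}(\Omega)}{f_{0}(\Omega)^{r}}\right]d\Omega,$$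 with $$f_{m}^{(r)}(\Omega)=\sum_{\substack{n_{1}+n_{2}+\cdots+n_{r}=m\\ n_{i}\geq1,\ i=1,\dots,r}}f_{n_{1}}(\Omega)f_{n_{2}}(\Omega)\cdots f_{n_{r}}(\Omega),$$ and where empty sums are understood to be $1$ (so for $m=0$ the sum over $r$ equals $1$).
   Context: Spherical coordinates: $\rho=|\mathbf{x}|=\sqrt{(x^{1})^{2}+\cdots+(x^{d})^{2}}$ and $\Omega=\mathbf{x}/\rho\in S^{d-1}=\{|\mathbf{x}|=1\}\subset\mathbb{R}^{d}$; $f(\rho,\Omega)$ means $f(\rho\Omega)$, and similarly for $g$. $d\Omega$ is the standard surface measure on $S^{d-1}$ (counting measure on $S^{0}=\{\pm1\}$ if $d=1$). The expansions of $f$ and $g$ are asymptotic expansions as $|\mathbf{x}|\to0$, i.e. the $o(\cdot)$ error terms are uniform in $\Omega$. Integrals are Lebesgue integrals, and "converges" means the integrand is Lebesgue integrable. $\binom{\alpha}{r}=\alpha(\alpha-1)\cdots(\alpha-r+1)/r!$ for real $\alpha$. $h(k)=o(k^{p})$ as $k\to\infty$ means $\lim_{k\to\infty}k^{-p}h(k)=0$. *)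

theory Defs
  imports "HOL-Analysis.Analysis" "HOL-Library.Landau_Symbols"
begin

text \<open>
  Surface measure \<open>d\<Omega>\<close> on the unit sphere: a Borel set \<open>A\<close> of the sphere has measure \<open>d\<close> times the
  volume of the cone \<open>{x. 0 < norm x < 1 \<and> x /\<^sub>R norm x \<in> A}\<close> over it (lemma
  \<open>emeasure_sphere_measure\<close>), where \<open>d\<close> is the dimension of the ambient space.  The measure is
  completed because the coefficient functions \<open>g\<^sub>j\<close> of a Lebesgue measurable \<open>g\<close> agree with Borel
  functions only up to null sets of the sphere.  For \<open>d = 1\<close> this is counting measure on
  \<open>{-1, 1}\<close> (lemma \<open>emeasure_sphere_measure_real\<close>).
\<close>

definition sphere_measure :: "'a::euclidean_space measure" where
  "sphere_measure =
     completion
       (distr (scale_measure (of_nat DIM('a)) (restrict_space lborel (ball 0 1 - {0})))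
              (restrict_space borel (sphere 0 1))
              (\<lambda>x. x /\<^sub>R norm x))"

lemma measurable_radial_projection:
  "(\<lambda>x::'a::euclidean_space. x /\<^sub>R norm x) \<in>
     measurable (scale_measure c (restrict_space lborel (ball 0 1 - {0})))
                (restrict_space borel (sphere 0 1))"
proof -
  have "(\<lambda>x::'a. x /\<^sub>R norm x) \<in>
      measurable (restrict_space lborel (ball 0 1 - {0})) (restrict_space borel (sphere 0 1))"
    by (rule measurable_restrict_space3) auto
  then show ?thesis
    by (simp add: measurable_def space_scale_measure)
qed

lemma emeasure_sphere_measure:
  fixes A :: "'a::euclidean_space set"
  assumes "A \<in> sets borel" "A \<subseteq> sphere 0 1"
  shows "emeasure sphere_measure A =
           of_nat DIM('a) * emeasure lborel {x. 0 < norm x \<and> norm x < 1 \<and> x /\<^sub>R norm x \<in> A}"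
proof -
  let ?p = "\<lambda>x::'a. x /\<^sub>R norm x" and ?B = "ball 0 1 - {0} :: 'a set"
  have A: "A \<in> sets (restrict_space borel (sphere 0 1))"
    using assms by (simp add: sets_restrict_space_iff)
  have eq: "?p -` A \<inter> ?B = {x. 0 < norm x \<and> norm x < 1 \<and> ?p x \<in> A}"
    by auto
  show ?thesis
    unfolding sphere_measure_def eq[symmetric] using A
    by (simp add: emeasure_distr[OF measurable_radial_projection] space_scale_measure
        space_restrict_space emeasure_restrict_space)
qed

lemma emeasure_sphere_measure_real:
  assumes "A \<subseteq> sphere (0::real) 1"
  shows "emeasure sphere_measure A = of_nat (card A)"
proof -
  have S: "sphere (0::real) 1 = {-1, 1}" by (auto simp: abs_if split: if_splits)
  have "A \<in> {{}, {-1}, {1}, {-1, 1}}"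
    using assms unfolding S by auto
  moreover have "{x::real. 0 < norm x \<and> norm x < 1 \<and> x /\<^sub>R norm x \<in> {1}} = {0<..<1}"
    by (auto simp: field_simps abs_if split: if_splits)
  moreover have "{x::real. 0 < norm x \<and> norm x < 1 \<and> x /\<^sub>R norm x \<in> {-1}} = {-1<..<0}"
    by (auto simp: field_simps abs_if split: if_splits)
  moreover have "{x::real. 0 < norm x \<and> norm x < 1 \<and> x /\<^sub>R norm x \<in> {-1, 1}} = {-1<..<0} \<union> {0<..<1}"
    by (auto simp: field_simps abs_if split: if_splits)
  moreover have "emeasure lborel ({-1<..<0} \<union> {0<..<1::real}) = 2"
    by (subst plus_emeasure[symmetric]) auto
  ultimately show ?thesis
    using emeasure_sphere_measure[of A] assms by (auto simp: S)
qed

text \<open>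
  The filter of pairs \<open>(\<rho>, \<Omega>)\<close> with \<open>\<rho> \<rightarrow> 0+\<close>, uniformly in \<open>\<Omega>\<close> on the unit sphere; a Landau symbol
  with respect to it is an asymptotic relation as \<open>norm x \<rightarrow> 0\<close> for \<open>x = \<rho> *\<^sub>R \<Omega>\<close>
  (lemma \<open>smallo_polar_at_0_iff\<close>).
\<close>

definition polar_at_0 :: "(real \<times> 'a::real_normed_vector) filter" where
  "polar_at_0 = at_right 0 \<times>\<^sub>F principal (sphere 0 1)"

lemma smallo_polar_at_0_iff:
  fixes h e :: "real \<times> 'a::real_normed_vector \<Rightarrow> real"
  shows "h \<in> o[polar_at_0](e) \<longleftrightarrow>
    (\<forall>c>0. \<exists>\<delta>>0. \<forall>\<rho>. 0 < \<rho> \<and> \<rho> < \<delta> \<longrightarrow>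
       (\<forall>\<Omega>\<in>sphere 0 1. \<bar>h (\<rho>, \<Omega>)\<bar> \<le> c * \<bar>e (\<rho>, \<Omega>)\<bar>))"
proof -
  have "eventually P (polar_at_0 :: (real \<times> 'a) filter) \<longleftrightarrow>
      (\<exists>\<delta>>0. \<forall>\<rho>. 0 < \<rho> \<and> \<rho> < \<delta> \<longrightarrow> (\<forall>\<Omega>\<in>sphere 0 1. P (\<rho>, \<Omega>)))" for P
    unfolding polar_at_0_def eventually_prod_filter eventually_principal eventually_at_right_field
  proof safe
    fix Q :: "real \<Rightarrow> bool" and S :: "'a \<Rightarrow> bool" and \<delta> :: real
    assume "0 < \<delta>" "\<forall>y>0. y < \<delta> \<longrightarrow> Q y" "\<forall>x\<in>sphere 0 1. S x" "\<forall>x y. Q x \<longrightarrow> S y \<longrightarrow> P (x, y)"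
    then show "\<exists>\<delta>>0. \<forall>\<rho>. 0 < \<rho> \<and> \<rho> < \<delta> \<longrightarrow> (\<forall>\<Omega>\<in>sphere 0 1. P (\<rho>, \<Omega>))"
      by blast
  next
    fix \<delta> :: real
    assume "0 < \<delta>" "\<forall>\<rho>. 0 < \<rho> \<and> \<rho> < \<delta> \<longrightarrow> (\<forall>\<Omega>\<in>sphere 0 1. P (\<rho>, \<Omega>))"
    then show "\<exists>Pf Pg. (\<exists>b>0. \<forall>y>0. y < b \<longrightarrow> Pf y) \<and> (\<forall>x\<in>sphere 0 1. Pg x) \<and>
        (\<forall>x y. Pf x \<longrightarrow> Pg y \<longrightarrow> P (x, y))"
      by (intro exI[of _ "\<lambda>\<rho>. \<forall>\<Omega>\<in>sphere 0 1. P (\<rho>, \<Omega>)"] exI[of _ "\<lambda>\<Omega>. \<Omega> \<in> sphere 0 1"]) blast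
  qed
  then show ?thesis
    by (simp add: smallo_def)
qed

text \<open>
  The paper's \<open>f_m^(r)\<close>, with \<open>a i\<close> in place of \<open>f\<^sub>i(\<Omega>)\<close>: the sum over all \<open>r\<close>-tuples of
  positive integers with total \<open>m\<close>.
\<close>

definition composition_sum :: "(nat \<Rightarrow> real) \<Rightarrow> nat \<Rightarrow> nat \<Rightarrow> real" where
  "composition_sum a r m =
     (\<Sum>ns | length ns = r \<and> sum_list ns = m \<and> (\<forall>n\<in>set ns. 1 \<le> n). prod_list (map a ns))"

lemma finite_compositions:
  "finite {ns :: nat list. length ns = r \<and> sum_list ns = m \<and> (\<forall>n\<in>set ns. 1 \<le> n)}"
  by (rule finite_subset[OF _ finite_lists_length_eq[of "{..m}" r]])
     (auto dest: member_le_sum_list)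

text \<open>
  The arguments \<open>F\<close> and \<open>G\<close> are the families \<open>f\<^sub>j\<close> and \<open>g\<^sub>j\<close> of functions on the unit sphere.
  The conditional implements the convention that the empty sum over \<open>r\<close> (for \<open>m = 0\<close>) is \<open>1\<close>.
\<close>

definition zeta_integrand ::
    "real \<Rightarrow> real \<Rightarrow> (nat \<Rightarrow> 'a \<Rightarrow> real) \<Rightarrow> (nat \<Rightarrow> 'a \<Rightarrow> real) \<Rightarrow> nat \<Rightarrow> 'a \<Rightarrow> real" where
  "zeta_integrand \<nu> lam F G j \<Omega> =
     F 0 \<Omega> powr (- ((real j + lam) / \<nu>)) *
     (\<Sum>m=0..j. G (j - m) \<Omega> *
        (if m = 0 then 1
         else \<Sum>r=1..m. ((- ((real j + lam) / \<nu>)) gchoose r) *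
                (composition_sum (\<lambda>i. F i \<Omega>) r m / F 0 \<Omega> ^ r)))"

definition zeta_coeff ::
    "real \<Rightarrow> real \<Rightarrow> (nat \<Rightarrow> 'a::euclidean_space \<Rightarrow> real) \<Rightarrow> (nat \<Rightarrow> 'a \<Rightarrow> real) \<Rightarrow> nat \<Rightarrow> real" where
  "zeta_coeff \<nu> lam F G j =
     1 / \<nu> * Gamma ((real j + lam) / \<nu>) *
     (\<integral>\<Omega>. zeta_integrand \<nu> lam F G j \<Omega> \<partial>sphere_measure)"

end

theory Submission
  imports Defs
begin

text \<open>
  Write \<open>x = \<rho> \<Omega>\<close> and \<open>u = k \<rho>\<^sup>\<nu>\<close>.  Near the origin \<open>k f = u (f\<^sub>0 + f\<^sub>1 \<rho> + \<dots>)\<close>, and treating \<open>u\<close> as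
  a quantity independent of \<open>\<rho>\<close> one expands \<open>exp (- u (f\<^sub>1 \<rho> + f\<^sub>2 \<rho>\<^sup>2 + \<dots>))\<close> in powers of \<open>\<rho>\<close> and
  multiplies by the expansion of \<open>g\<close>.  Cut off after \<open>\<rho>\<^sup>N\<close>, this yields an explicit integrand
  (\<open>model_integrand\<close>) which is a finite sum of terms
  \<open>\<rho> powr (j + \<lambda> - d) * u ^ r * exp (- u f\<^sub>0(\<Omega>)) * h(\<Omega>)\<close>.  In polar coordinates the radial integral
  of such a term over the whole half-line is a Gamma function, and it carries the factor
  \<open>k powr (- (j + \<lambda>) / \<nu>)\<close>.  Since \<open>(-1)\<^sup>r / r! * \<Gamma>(\<alpha> + r) = \<Gamma>(\<alpha>) * (- \<alpha> gchoose r)\<close>, the integral of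
  the model over all of space equals \<open>\<Sum>j\<le>N. \<zeta>\<^sub>j k powr (- (j + \<lambda>) / \<nu>)\<close> exactly
  (\<open>has_bochner_integral_laplace_model\<close>).

  The integrand is compared with the model pointwise.  Given \<open>\<epsilon> > 0\<close> there is a radius \<open>\<delta>\<close> inside
  which the difference is at most
  \<open>\<epsilon> \<rho> powr (N + \<lambda> - d) * exp (- \<kappa> u) * H(\<Omega>)\<close> (\<open>integrand_minus_model_near_0\<close>); the powers of \<open>u\<close>
  that the expansion produces have been absorbed by giving up part of the exponential rate.  Outside
  that radius the model is bounded by a constant times the same expression with \<open>N + 1\<close> in place of
  \<open>N\<close> (\<open>model_integrand_away_from_0\<close>), whereas the integrand is exponentially small because \<open>f\<close> is
  bounded away from \<open>0\<close> there.  Integrated, the three bounds are \<open>\<epsilon> O(k powr (- (N + \<lambda>) / \<nu>))\<close>,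
  \<open>O(k powr (- (N + 1 + \<lambda>) / \<nu>))\<close> and \<open>O(exp (- m k))\<close>.

  The coefficients \<open>g\<^sub>j\<close> are arbitrary functions, so it has to be proved that they are
  integrable over the sphere (\<open>integrable_expansion_coefficients\<close>).  By Fubini's theorem
  \<open>g(\<rho> \<Omega>)\<close> is an integrable function of \<open>\<Omega>\<close> for almost every small \<open>\<rho>\<close>.  Limits along a sequence of such
  \<open>\<rho>\<close> show that the \<open>g\<^sub>j\<close> are measurable, and the polynomial \<open>\<Sum>j\<le>N. g\<^sub>j(\<Omega>) \<rho>\<^sup>j\<close>, which is
  integrable for infinitely many \<open>\<rho>\<close>, has integrable coefficients.
\<close>

section \<open>Truncated power series of the exponential\<close>

lemma composition_sum_0: "composition_sum a 0 m = (if m = 0 then 1 else 0)"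
proof -
  have "{ns :: nat list. length ns = 0 \<and> sum_list ns = m \<and> (\<forall>n\<in>set ns. 1 \<le> n)}
      = (if m = 0 then {[]} else {})"
    by auto
  then show ?thesis by (simp add: composition_sum_def)
qed

lemma composition_sum_Suc:
  "composition_sum a (Suc r) m = (\<Sum>n=1..m. a n * composition_sum a r (m - n))"
proof -
  define C where
    "C r m = {ns :: nat list. length ns = r \<and> sum_list ns = m \<and> (\<forall>n\<in>set ns. 1 \<le> n)}" for r m
  have fin: "finite (C r m)" for r m
    unfolding C_def by (rule finite_compositions)
  have "bij_betw (\<lambda>(n, ns). n # ns) (SIGMA n:{1..m}. C r (m - n)) (C (Suc r) m)"
  proof (rule bij_betwI[where g = "\<lambda>ns. (hd ns, tl ns)"])
    show "(\<lambda>ns. (hd ns, tl ns)) \<in> C (Suc r) m \<rightarrow> (SIGMA n:{1..m}. C r (m - n))"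
      by (auto simp: C_def length_Suc_conv)
  qed (auto simp: C_def length_Suc_conv)
  then have "(\<Sum>ns\<in>C (Suc r) m. prod_list (map a ns))
      = (\<Sum>(n, ns)\<in>(SIGMA n:{1..m}. C r (m - n)). a n * prod_list (map a ns))"
    by (subst sum.reindex_bij_betw[symmetric]) (auto intro!: sum.cong)
  also have "\<dots> = (\<Sum>n=1..m. \<Sum>ns\<in>C r (m - n). a n * prod_list (map a ns))"
    by (rule sum.Sigma[symmetric]) (auto simp: fin)
  finally show ?thesis
    unfolding composition_sum_def C_def by (simp add: sum_distrib_left)
qed

lemma composition_sum_eq_0: "m < r \<Longrightarrow> composition_sum a r m = 0"
proof (induction r arbitrary: m)
  case (Suc r)
  then show ?case unfolding composition_sum_Suc by (intro sum.neutral) auto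
qed simp

lemma abs_composition_sum_le:
  assumes "\<And>j. j \<le> N \<Longrightarrow> \<bar>a j\<bar> \<le> B" and "m \<le> N"
  shows "\<bar>composition_sum a r m\<bar> \<le> (real N * B) ^ r"
  using \<open>m \<le> N\<close>
proof (induction r arbitrary: m)
  case 0
  then show ?case by (simp add: composition_sum_0)
next
  case (Suc r)
  have B: "0 \<le> B" using assms(1)[of 0] by linarith
  have "\<bar>composition_sum a (Suc r) m\<bar> \<le> (\<Sum>n=1..m. \<bar>a n\<bar> * \<bar>composition_sum a r (m - n)\<bar>)"
    unfolding composition_sum_Suc abs_mult[symmetric] by (rule sum_abs)
  also have "\<dots> \<le> (\<Sum>n=1..m. B * (real N * B) ^ r)"
    using Suc B by (intro sum_mono mult_mono assms Suc.IH) auto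
  also have "\<dots> = real m * (B * (real N * B) ^ r)" by simp
  also have "\<dots> \<le> real N * (B * (real N * B) ^ r)"
    using Suc.prems B by (intro mult_right_mono) auto
  finally show ?case by (simp add: mult_ac)
qed

text \<open>
  Modulo \<open>\<rho> ^ (N + 1)\<close> the product of two polynomials is given by the Cauchy product of their
  coefficients; each of the discarded monomials has degree at least \<open>N + 1\<close>.
\<close>

lemma truncated_product_bound:
  fixes x y :: "nat \<Rightarrow> real"
  assumes "0 \<le> \<rho>" "\<rho> \<le> 1"
  shows "\<bar>(\<Sum>i\<le>N. x i * \<rho> ^ i) * (\<Sum>j\<le>N. y j * \<rho> ^ j)
            - (\<Sum>m\<le>N. (\<Sum>i\<le>m. x i * y (m - i)) * \<rho> ^ m)\<bar>
         \<le> (\<Sum>i\<le>N. \<bar>x i\<bar>) * (\<Sum>j\<le>N. \<bar>y j\<bar>) * \<rho> ^ (N + 1)"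
proof -
  define h where "h = (\<lambda>(i, j). x i * y j * \<rho> ^ (i + j))"
  let ?Q = "{..N} \<times> {..N}" and ?T = "{(i, j). i + j \<le> N}"
  have sub: "?T \<subseteq> ?Q" by auto
  have prod: "(\<Sum>i\<le>N. x i * \<rho> ^ i) * (\<Sum>j\<le>N. y j * \<rho> ^ j) = sum h ?Q"
    by (simp add: sum_product sum.cartesian_product h_def power_add mult_ac)
  have "(\<Sum>m\<le>N. (\<Sum>i\<le>m. x i * y (m - i)) * \<rho> ^ m)
      = (\<Sum>m\<le>N. \<Sum>i\<le>m. x i * y (m - i) * \<rho> ^ (i + (m - i)))"
    by (simp add: sum_distrib_right)
  also have "\<dots> = sum h ?T"
    unfolding h_def by (rule sum.triangle_reindex_eq[symmetric])
  finally have "(\<Sum>i\<le>N. x i * \<rho> ^ i) * (\<Sum>j\<le>N. y j * \<rho> ^ j)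
            - (\<Sum>m\<le>N. (\<Sum>i\<le>m. x i * y (m - i)) * \<rho> ^ m) = sum h (?Q - ?T)"
    unfolding prod using sub by (simp add: sum_diff)
  also have "\<bar>\<dots>\<bar> \<le> (\<Sum>z\<in>?Q - ?T. \<bar>h z\<bar>)" by (rule sum_abs)
  also have "\<dots> \<le> (\<Sum>(i, j)\<in>?Q - ?T. \<bar>x i\<bar> * \<bar>y j\<bar> * \<rho> ^ (N + 1))"
    using assms
    by (intro sum_mono)
       (auto simp: h_def abs_mult power_abs simp del: power_Suc intro!: mult_left_mono power_decreasing)
  also have "\<dots> \<le> (\<Sum>(i, j)\<in>?Q. \<bar>x i\<bar> * \<bar>y j\<bar> * \<rho> ^ (N + 1))"
    using assms by (intro sum_mono2) auto
  also have "\<dots> = (\<Sum>(i, j)\<in>?Q. \<bar>x i\<bar> * \<bar>y j\<bar>) * \<rho> ^ (N + 1)"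
    by (simp add: sum_distrib_right case_prod_beta del: power_Suc)
  also have "\<dots> = (\<Sum>i\<le>N. \<bar>x i\<bar>) * (\<Sum>j\<le>N. \<bar>y j\<bar>) * \<rho> ^ (N + 1)"
    by (simp only: sum_product sum.cartesian_product)
  finally show ?thesis .
qed

text \<open>
  By the recursion \<open>composition_sum_Suc\<close> the numbers \<open>composition_sum a r m\<close> are the coefficients of
  the \<open>r\<close>-th power of \<open>\<Sum>j\<ge>1. a j * \<rho> ^ j\<close>.  What matters is that the remainder depends on \<open>a\<close>
  only through the bound \<open>B\<close>, so that it is uniform over the sphere when \<open>a\<close> varies with \<open>\<Omega>\<close>.
\<close>

lemma power_truncation_bound:
  assumes a: "\<And>j. j \<le> N \<Longrightarrow> \<bar>a j\<bar> \<le> B" and \<rho>: "0 \<le> \<rho>" "\<rho> \<le> 1"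
  shows "\<bar>(\<Sum>j=1..N. a j * \<rho> ^ j) ^ r - (\<Sum>m\<le>N. composition_sum a r m * \<rho> ^ m)\<bar>
         \<le> real r * real (N + 1) * (real N * B) ^ r * \<rho> ^ (N + 1)"
proof (induction r)
  case 0
  have "(\<Sum>m\<le>N. (if m = 0 then 1 else 0) * \<rho> ^ m) = 1"
    by (simp add: if_distrib if_distribR cong: if_cong)
  then show ?case by (simp add: composition_sum_0)
next
  case (Suc r)
  define L where "L = real N * B"
  define q where "q = (\<Sum>j=1..N. a j * \<rho> ^ j)"
  define T where "T r = (\<Sum>m\<le>N. composition_sum a r m * \<rho> ^ m)" for r
  define x where "x i = (if i = 0 then 0 else a i)" for i
  have B: "0 \<le> B" using a[of 0] by linarith
  have L: "0 \<le> L" using B by (simp add: L_def)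
  have ins: "{..N} = insert 0 {1..N}" by auto
  have q: "q = (\<Sum>i\<le>N. x i * \<rho> ^ i)"
    unfolding ins q_def x_def by (simp add: sum.insert_remove)
  have sx: "(\<Sum>i\<le>N. \<bar>x i\<bar>) \<le> L"
  proof -
    have "(\<Sum>i\<le>N. \<bar>x i\<bar>) = (\<Sum>i=1..N. \<bar>a i\<bar>)" unfolding ins x_def by simp
    also have "\<dots> \<le> (\<Sum>i=1..N. B)" by (intro sum_mono a) auto
    finally show ?thesis by (simp add: L_def)
  qed
  have "\<bar>q\<bar> \<le> (\<Sum>i\<le>N. \<bar>x i * \<rho> ^ i\<bar>)" unfolding q by (rule sum_abs)
  also have "\<dots> \<le> (\<Sum>i\<le>N. \<bar>x i\<bar>)"
    using \<rho> by (intro sum_mono) (auto simp: abs_mult power_le_one intro: mult_left_le)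
  finally have qL: "\<bar>q\<bar> \<le> L" using sx by linarith
  have conv: "(\<Sum>i\<le>m. x i * composition_sum a r (m - i)) = composition_sum a (Suc r) m" for m
  proof -
    have "{..m} = insert 0 {1..m}" by auto
    then show ?thesis by (simp add: composition_sum_Suc x_def)
  qed
  have "\<bar>q * T r - T (Suc r)\<bar>
      \<le> (\<Sum>i\<le>N. \<bar>x i\<bar>) * (\<Sum>j\<le>N. \<bar>composition_sum a r j\<bar>) * \<rho> ^ (N + 1)"
    using truncated_product_bound[OF \<rho>, of x N "composition_sum a r"]
    unfolding q T_def conv .
  also have "\<dots> \<le> L * (\<Sum>j\<le>N. L ^ r) * \<rho> ^ (N + 1)"
    using \<rho> L unfolding L_def
    by (intro mult_right_mono mult_mono sum_mono abs_composition_sum_le a sx[unfolded L_def])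
       (auto intro!: sum_nonneg)
  finally have 1: "\<bar>q * T r - T (Suc r)\<bar> \<le> real (N + 1) * L ^ Suc r * \<rho> ^ (N + 1)"
    by (simp add: mult_ac)
  have "\<bar>q * (q ^ r - T r)\<bar> \<le> L * (real r * real (N + 1) * L ^ r * \<rho> ^ (N + 1))"
    unfolding abs_mult using Suc.IH L
    by (intro mult_mono qL) (auto simp: q_def T_def L_def)
  moreover have "q ^ Suc r - T (Suc r) = q * (q ^ r - T r) + (q * T r - T (Suc r))"
    by (simp add: algebra_simps)
  ultimately have "\<bar>q ^ Suc r - T (Suc r)\<bar>
      \<le> L * (real r * real (N + 1) * L ^ r * \<rho> ^ (N + 1)) + real (N + 1) * L ^ Suc r * \<rho> ^ (N + 1)"
    using 1 by linarith
  then show ?case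
    unfolding q_def T_def L_def by (simp add: algebra_simps)
qed

text \<open>
  The coefficient of \<open>\<rho> ^ m\<close> in \<open>exp (- u * (\<Sum>j\<ge>1. a j * \<rho> ^ j))\<close>, a polynomial in \<open>u\<close>; terms
  with \<open>r > m\<close> vanish by \<open>composition_sum_eq_0\<close>.
\<close>

definition exp_coeff :: "(nat \<Rightarrow> real) \<Rightarrow> nat \<Rightarrow> real \<Rightarrow> real" where
  "exp_coeff a m u = (\<Sum>r\<le>m. (- u) ^ r / fact r * composition_sum a r m)"

text \<open>
  This is how powers of \<open>u\<close> are disposed of: they cost an arbitrarily small part of the decay
  rate in \<open>exp (- c * u)\<close>.
\<close>

lemma powers_le_exp:
  fixes \<kappa> :: real
  assumes "0 < \<kappa>"
  shows "\<exists>A\<ge>1. \<forall>u\<ge>0. \<forall>r\<le>n. u ^ r \<le> A * exp (\<kappa> * u)"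
proof -
  define A where "A = 1 + (\<Sum>r\<le>n. fact r / \<kappa> ^ r)"
  have nn: "0 \<le> (\<Sum>r\<le>n. fact r / \<kappa> ^ r)" using assms by (intro sum_nonneg) auto
  have "u ^ r \<le> A * exp (\<kappa> * u)" if "0 \<le> u" "r \<le> n" for u r
  proof -
    have "(\<kappa> * u) ^ r / fact r \<le> exp (\<kappa> * u)"
    proof -
      have "(\<Sum>i\<in>{r}. (\<kappa> * u) ^ i /\<^sub>R fact i) \<le> (\<Sum>i. (\<kappa> * u) ^ i /\<^sub>R fact i)"
        using assms that by (intro sum_le_suminf summable_exp_generic) auto
      then show ?thesis by (simp add: exp_def divide_inverse mult.commute)
    qed
    then have "u ^ r \<le> fact r / \<kappa> ^ r * exp (\<kappa> * u)"
      using assms by (simp add: field_simps power_mult_distrib)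
    also have "fact r / \<kappa> ^ r \<le> A"
      unfolding A_def using assms that member_le_sum[of r "{..n}" "\<lambda>r. fact r / \<kappa> ^ r"] by force
    finally show ?thesis by simp
  qed
  then show ?thesis using nn by (intro exI[of _ A]) (auto simp: A_def)
qed

lemma abs_exp_coeff_le:
  assumes "0 < \<kappa>"
  shows "\<exists>A\<ge>0. \<forall>a. (\<forall>j\<le>N. \<bar>a j\<bar> \<le> B) \<longrightarrow>
           (\<forall>u\<ge>0. \<forall>m\<le>N. \<bar>exp_coeff a m u\<bar> \<le> A * exp (\<kappa> * u))"
proof -
  obtain A0 where A0: "A0 \<ge> 1" "\<And>u r. 0 \<le> u \<Longrightarrow> r \<le> N \<Longrightarrow> u ^ r \<le> A0 * exp (\<kappa> * u)"
    using powers_le_exp[OF assms, of N] by blast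
  define A where "A = (\<Sum>r\<le>N. A0 * \<bar>real N * B\<bar> ^ r)"
  have "\<bar>exp_coeff a m u\<bar> \<le> A * exp (\<kappa> * u)"
    if a: "\<forall>j\<le>N. \<bar>a j\<bar> \<le> B" and u: "0 \<le> u" and m: "m \<le> N" for a u m
  proof -
    have B: "0 \<le> B" using a by force
    have "\<bar>exp_coeff a m u\<bar> \<le> (\<Sum>r\<le>m. \<bar>(- u) ^ r / fact r * composition_sum a r m\<bar>)"
      unfolding exp_coeff_def by (rule sum_abs)
    also have "\<dots> \<le> (\<Sum>r\<le>m. (A0 * exp (\<kappa> * u)) * \<bar>real N * B\<bar> ^ r)"
    proof (intro sum_mono)
      fix r assume r: "r \<in> {..m}"
      have "\<bar>(- u) ^ r / fact r\<bar> = u ^ r / fact r" using u by (simp add: power_abs)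
      also have "\<dots> \<le> u ^ r / 1"
        using u fact_ge_1[of r, where 'a=real] by (intro divide_left_mono) auto
      finally have "\<bar>(- u) ^ r / fact r\<bar> \<le> A0 * exp (\<kappa> * u)"
        using A0(2)[of u r] u r m by auto
      then show "\<bar>(- u) ^ r / fact r * composition_sum a r m\<bar>
          \<le> (A0 * exp (\<kappa> * u)) * \<bar>real N * B\<bar> ^ r"
        unfolding abs_mult using abs_composition_sum_le[of N a B m r] a m A0 B
        by (intro mult_mono) auto
    qed
    also have "\<dots> \<le> (\<Sum>r\<le>N. (A0 * exp (\<kappa> * u)) * \<bar>real N * B\<bar> ^ r)"
      using m A0 by (intro sum_mono2) auto
    also have "\<dots> = A * exp (\<kappa> * u)"
      by (simp add: A_def sum_distrib_left sum_distrib_right mult_ac)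
    finally show ?thesis .
  qed
  moreover have "0 \<le> A" using A0 by (auto simp: A_def intro!: sum_nonneg)
  ultimately show ?thesis by blast
qed

text \<open>
  Taylor's formula for \<open>exp (- u * q)\<close> to order \<open>N\<close> in \<open>q = (\<Sum>j\<ge>1. a j * \<rho> ^ j)\<close>, followed by the
  truncation of each power of \<open>q\<close>.  Taylor's remainder may grow like \<open>exp (u * \<bar>q\<bar>)\<close>, but for
  small \<open>\<rho>\<close> one has \<open>\<bar>q\<bar> \<le> c0 / 2\<close>, and the factor \<open>exp (- u * a 0)\<close> wins.
\<close>

lemma exp_truncation_bound:
  fixes c0 B :: real
  assumes c0: "0 < c0" and B: "0 \<le> B"
  shows "\<exists>K\<ge>0. \<exists>\<delta>>0. \<delta> \<le> 1 \<and> (\<forall>a \<rho> u. c0 \<le> a 0 \<longrightarrow> (\<forall>j\<le>N. \<bar>a j\<bar> \<le> B) \<longrightarrow> 0 < \<rho> \<longrightarrow> \<rho> < \<delta> \<longrightarrow> 0 \<le> u \<longrightarrow>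
           c0 / 2 \<le> (\<Sum>j\<le>N. a j * \<rho> ^ j) \<and>
           \<bar>exp (- u * (\<Sum>j\<le>N. a j * \<rho> ^ j)) - exp (- u * a 0) * (\<Sum>m\<le>N. exp_coeff a m u * \<rho> ^ m)\<bar>
             \<le> K * \<rho> ^ (N + 1) * exp (- (c0 / 4) * u))"
proof -
  define L where "L = real N * B"
  have L: "0 \<le> L" using B by (simp add: L_def)
  obtain A where A: "A \<ge> 1" "\<And>u r. 0 \<le> u \<Longrightarrow> r \<le> N + 1 \<Longrightarrow> u ^ r \<le> A * exp ((c0 / 4) * u)"
    using powers_le_exp[of "c0 / 4" "N + 1"] c0 by auto
  define Q where "Q = (\<Sum>r\<le>N. real r * real (N + 1) * L ^ r)"
  have Q: "0 \<le> Q" unfolding Q_def using L by (intro sum_nonneg) auto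
  define K where "K = A * L ^ (N + 1) + A * Q"
  define \<delta> where "\<delta> = min 1 (c0 / (2 * (L + 1)))"
  have \<delta>: "0 < \<delta>" "\<delta> \<le> 1" using c0 L by (auto simp: \<delta>_def)
  have main: "c0 / 2 \<le> (\<Sum>j\<le>N. a j * \<rho> ^ j) \<and>
      \<bar>exp (- u * (\<Sum>j\<le>N. a j * \<rho> ^ j)) - exp (- u * a 0) * (\<Sum>m\<le>N. exp_coeff a m u * \<rho> ^ m)\<bar>
      \<le> K * \<rho> ^ (N + 1) * exp (- (c0 / 4) * u)"
    if a0: "c0 \<le> a 0" and a: "\<forall>j\<le>N. \<bar>a j\<bar> \<le> B" and \<rho>: "0 < \<rho>" "\<rho> < \<delta>" and u: "0 \<le> u" for a \<rho> u
  proof -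
    define q where "q = (\<Sum>j=1..N. a j * \<rho> ^ j)"
    define T where "T r = (\<Sum>m\<le>N. composition_sum a r m * \<rho> ^ m)" for r
    have \<rho>1: "0 \<le> \<rho>" "\<rho> \<le> 1" using \<rho> \<delta> by auto
    have "\<bar>q\<bar> \<le> (\<Sum>j=1..N. \<bar>a j * \<rho> ^ j\<bar>)" unfolding q_def by (rule sum_abs)
    also have "\<dots> \<le> (\<Sum>j=1..N. B * \<rho>)"
    proof (intro sum_mono)
      fix j assume j: "j \<in> {1..N}"
      have "\<rho> ^ j \<le> \<rho> ^ 1" using j \<rho>1 by (intro power_decreasing) auto
      then show "\<bar>a j * \<rho> ^ j\<bar> \<le> B * \<rho>"
        using a j \<rho>1 B by (auto simp: abs_mult intro!: mult_mono)
    qed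
    finally have qL: "\<bar>q\<bar> \<le> L * \<rho>" by (simp add: L_def)
    have "\<rho> * (2 * (L + 1)) \<le> c0" using \<rho> L by (simp add: \<delta>_def pos_less_divide_eq)
    then have "L * \<rho> \<le> c0 / 2" using \<rho>1 by (simp add: algebra_simps)
    with qL have qc: "\<bar>q\<bar> \<le> c0 / 2" by linarith
    have split: "(\<Sum>j\<le>N. a j * \<rho> ^ j) = a 0 + q"
    proof -
      have "{..N} = insert 0 {1..N}" by auto
      then show ?thesis by (simp add: q_def)
    qed
    obtain t where t: "\<bar>t\<bar> \<le> \<bar>- u * q\<bar>"
      "exp (- u * q) = (\<Sum>r<N + 1. (- u * q) ^ r / fact r) + exp t / fact (N + 1) * (- u * q) ^ (N + 1)"
      using Maclaurin_exp_le[of "- u * q" "N + 1"] by blast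
    let ?R1 = "exp t / fact (N + 1) * (- u * q) ^ (N + 1)"
    let ?R2 = "\<Sum>r\<le>N. (- u) ^ r / fact r * (q ^ r - T r)"
    have "exp t / fact (N + 1) \<le> exp t"
      using fact_ge_1[of "N + 1", where 'a=real] by (simp add: divide_le_eq del: fact_Suc)
    also have "exp t \<le> exp (c0 / 2 * u)"
    proof -
      have "\<bar>t\<bar> \<le> u * \<bar>q\<bar>" using t(1) u by (simp add: abs_mult)
      also have "\<dots> \<le> u * (c0 / 2)" using qc u by (intro mult_left_mono)
      finally show ?thesis by (simp add: mult.commute)
    qed
    finally have f1: "exp t / fact (N + 1) \<le> exp (c0 / 2 * u)" .
    have "\<bar>?R1\<bar> = (exp t / fact (N + 1)) * (u ^ (N + 1) * \<bar>q\<bar> ^ (N + 1))"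
      using u by (simp add: abs_mult power_abs power_mult_distrib del: power_Suc fact_Suc)
    also have "\<dots> \<le> exp (c0 / 2 * u) * ((A * exp (c0 / 4 * u)) * (L * \<rho>) ^ (N + 1))"
      using A(1) u L \<rho>1 qL
      by (intro mult_mono f1 A(2) power_mono mult_nonneg_nonneg) auto
    also have "\<dots> = (A * L ^ (N + 1)) * \<rho> ^ (N + 1) * (exp (c0 / 2 * u) * exp (c0 / 4 * u))"
      by (simp add: power_mult_distrib mult_ac)
    also have "exp (c0 / 2 * u) * exp (c0 / 4 * u) = exp (3 * c0 / 4 * u)"
      unfolding exp_add[symmetric] by (simp add: field_simps)
    finally have R1: "\<bar>?R1\<bar> \<le> (A * L ^ (N + 1)) * \<rho> ^ (N + 1) * exp (3 * c0 / 4 * u)" .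
    have "\<bar>?R2\<bar> \<le> (\<Sum>r\<le>N. \<bar>(- u) ^ r / fact r * (q ^ r - T r)\<bar>)" by (rule sum_abs)
    also have "\<dots> \<le> (\<Sum>r\<le>N. (A * exp (c0 / 4 * u)) * (real r * real (N + 1) * L ^ r * \<rho> ^ (N + 1)))"
    proof (intro sum_mono)
      fix r assume r: "r \<in> {..N}"
      have "\<bar>(- u) ^ r / fact r\<bar> = u ^ r / fact r" using u by (simp add: power_abs)
      also have "\<dots> \<le> u ^ r / 1"
        using u fact_ge_1[of r, where 'a=real] by (intro divide_left_mono) auto
      finally have "\<bar>(- u) ^ r / fact r\<bar> \<le> A * exp (c0 / 4 * u)"
        using A(2)[of u r] u r by auto
      moreover have "\<bar>q ^ r - T r\<bar> \<le> real r * real (N + 1) * L ^ r * \<rho> ^ (N + 1)"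
        unfolding q_def T_def L_def using a \<rho>1 by (intro power_truncation_bound) auto
      ultimately show "\<bar>(- u) ^ r / fact r * (q ^ r - T r)\<bar>
          \<le> (A * exp (c0 / 4 * u)) * (real r * real (N + 1) * L ^ r * \<rho> ^ (N + 1))"
        unfolding abs_mult using A(1) by (intro mult_mono) auto
    qed
    also have "\<dots> = (A * Q) * \<rho> ^ (N + 1) * exp (c0 / 4 * u)"
      unfolding Q_def sum_distrib_left sum_distrib_right by (intro sum.cong refl) (simp add: mult_ac)
    also have "\<dots> \<le> (A * Q) * \<rho> ^ (N + 1) * exp (3 * c0 / 4 * u)"
      using A(1) Q \<rho>1 c0 u by (intro mult_left_mono) (auto intro!: mult_right_mono)
    finally have R2: "\<bar>?R2\<bar> \<le> (A * Q) * \<rho> ^ (N + 1) * exp (3 * c0 / 4 * u)" .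
    have coeff: "exp_coeff a m u = (\<Sum>r\<le>N. (- u) ^ r / fact r * composition_sum a r m)"
      if "m \<le> N" for m
      unfolding exp_coeff_def using that
      by (intro sum.mono_neutral_left) (auto simp: composition_sum_eq_0)
    have "(\<Sum>m\<le>N. exp_coeff a m u * \<rho> ^ m)
        = (\<Sum>m\<le>N. \<Sum>r\<le>N. (- u) ^ r / fact r * (composition_sum a r m * \<rho> ^ m))"
      by (intro sum.cong refl) (simp add: coeff sum_distrib_right mult.assoc)
    also have "\<dots> = (\<Sum>r\<le>N. (- u) ^ r / fact r * T r)"
      unfolding T_def sum_distrib_left by (rule sum.swap)
    finally have sumT: "(\<Sum>m\<le>N. exp_coeff a m u * \<rho> ^ m) = (\<Sum>r\<le>N. (- u) ^ r / fact r * T r)" .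
    have "(\<Sum>r<N + 1. (- u * q) ^ r / fact r) = (\<Sum>r\<le>N. (- u) ^ r / fact r * q ^ r)"
      by (intro sum.cong) (auto simp: power_mult_distrib[of "- u" q, simplified])
    then have "exp (- u * q) - (\<Sum>m\<le>N. exp_coeff a m u * \<rho> ^ m) = ?R2 + ?R1"
      unfolding sumT t(2) by (simp add: right_diff_distrib sum_subtractf)
    then have d: "\<bar>exp (- u * q) - (\<Sum>m\<le>N. exp_coeff a m u * \<rho> ^ m)\<bar>
        \<le> K * \<rho> ^ (N + 1) * exp (3 * c0 / 4 * u)"
      using R1 R2 unfolding K_def distrib_right by linarith
    have "exp (- u * (a 0 + q)) - exp (- u * a 0) * (\<Sum>m\<le>N. exp_coeff a m u * \<rho> ^ m)
        = exp (- u * a 0) * (exp (- u * q) - (\<Sum>m\<le>N. exp_coeff a m u * \<rho> ^ m))"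
      by (simp add: right_diff_distrib exp_add[symmetric] distrib_left)
    also have "\<bar>\<dots>\<bar> \<le> exp (- c0 * u) * (K * \<rho> ^ (N + 1) * exp (3 * c0 / 4 * u))"
      unfolding abs_mult using mult_right_mono[OF a0 u]
      by (intro mult_mono d) (auto simp: mult.commute)
    also have "\<dots> = K * \<rho> ^ (N + 1) * (exp (- c0 * u) * exp (3 * c0 / 4 * u))" by simp
    also have "exp (- c0 * u) * exp (3 * c0 / 4 * u) = exp (- (c0 / 4) * u)"
      unfolding exp_add[symmetric] by (simp add: field_simps)
    finally show ?thesis unfolding split using qc a0 by auto
  qed
  have "0 \<le> K" using A(1) L Q by (auto simp: K_def)
  with main \<delta> show ?thesis by blast
qed

lemma abs_exp_diff_le:
  fixes x y z :: real
  assumes "x \<le> z" "y \<le> z"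
  shows "\<bar>exp x - exp y\<bar> \<le> \<bar>x - y\<bar> * exp z"
proof -
  have 1: "exp b - exp a \<le> (b - a) * exp z" if "a \<le> b" "b \<le> z" for a b :: real
  proof -
    have "exp b * (1 + (a - b)) \<le> exp b * exp (a - b)"
      by (intro mult_left_mono exp_ge_add_one_self) auto
    also have "\<dots> = exp a" by (simp add: exp_add[symmetric])
    finally have "exp b - exp a \<le> (b - a) * exp b" by (simp add: algebra_simps)
    also have "\<dots> \<le> (b - a) * exp z" using that by (intro mult_left_mono) auto
    finally show ?thesis .
  qed
  show ?thesis
  proof (cases "x \<le> y")
    case True
    then show ?thesis using 1[of x y] assms by simp
  next
    case False
    then show ?thesis using 1[of y x] assms by simp
  qed
qed

text \<open>
  The product of the two expansions, cut off after \<open>\<rho> ^ N\<close>; \<open>a\<close> and \<open>b\<close> stand for the coefficients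
  of \<open>f\<close> and \<open>g\<close> in a fixed direction.
\<close>

definition laplace_model :: "nat \<Rightarrow> (nat \<Rightarrow> real) \<Rightarrow> (nat \<Rightarrow> real) \<Rightarrow> real \<Rightarrow> real \<Rightarrow> real" where
  "laplace_model N a b \<rho> u =
     exp (- u * a 0) * (\<Sum>j\<le>N. (\<Sum>m\<le>j. exp_coeff a m u * b (j - m)) * \<rho> ^ j)"

text \<open>
  The numbers \<open>e\<close> and \<open>e'\<close> are the errors of the expansions of \<open>f\<close> and \<open>g\<close> after division by
  their leading powers of \<open>\<rho>\<close>.  The difference is split into four parts: removing \<open>e\<close> from the
  exponent, removing \<open>e'\<close>, truncating the exponential, and truncating the product.
\<close>

lemma laplace_model_approx:
  fixes c0 B :: real
  assumes c0: "0 < c0" and B: "0 \<le> B"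
  shows "\<exists>K\<ge>0. \<exists>\<delta>>0. \<delta> \<le> 1 \<and> (\<forall>a b \<rho> u \<epsilon> e e'. c0 \<le> a 0 \<longrightarrow> (\<forall>j\<le>N. \<bar>a j\<bar> \<le> B) \<longrightarrow>
           0 < \<rho> \<longrightarrow> \<rho> < \<delta> \<longrightarrow> 0 \<le> u \<longrightarrow> \<epsilon> \<le> c0 / 4 \<longrightarrow> \<bar>e\<bar> \<le> \<epsilon> * \<rho> ^ N \<longrightarrow> \<bar>e'\<bar> \<le> \<epsilon> * \<rho> ^ N \<longrightarrow>
           \<bar>exp (- u * ((\<Sum>j\<le>N. a j * \<rho> ^ j) + e)) * ((\<Sum>j\<le>N. b j * \<rho> ^ j) + e') - laplace_model N a b \<rho> u\<bar>
             \<le> K * (\<epsilon> + \<rho>) * \<rho> ^ N * (1 + (\<Sum>j\<le>N. \<bar>b j\<bar>)) * exp (- (c0 / 8) * u))"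
proof -
  obtain K1 \<delta> where K1: "0 \<le> K1" and \<delta>: "0 < \<delta>" "\<delta> \<le> 1" and
    trunc: "\<And>a \<rho> u. c0 \<le> a 0 \<Longrightarrow> (\<forall>j\<le>N. \<bar>a j\<bar> \<le> B) \<Longrightarrow> 0 < \<rho> \<Longrightarrow> \<rho> < \<delta> \<Longrightarrow> 0 \<le> u \<Longrightarrow>
           c0 / 2 \<le> (\<Sum>j\<le>N. a j * \<rho> ^ j) \<and>
           \<bar>exp (- u * (\<Sum>j\<le>N. a j * \<rho> ^ j)) - exp (- u * a 0) * (\<Sum>m\<le>N. exp_coeff a m u * \<rho> ^ m)\<bar>
             \<le> K1 * \<rho> ^ (N + 1) * exp (- (c0 / 4) * u)"
    using exp_truncation_bound[OF c0 B, of N] by auto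
  obtain A1 where A1: "A1 \<ge> 1" "\<And>u r. 0 \<le> u \<Longrightarrow> r \<le> 1 \<Longrightarrow> u ^ r \<le> A1 * exp ((c0 / 8) * u)"
    using powers_le_exp[of "c0 / 8" 1] c0 by auto
  obtain A2 where A2: "A2 \<ge> 0" "\<And>a u m. (\<forall>j\<le>N. \<bar>a j\<bar> \<le> B) \<Longrightarrow> 0 \<le> u \<Longrightarrow> m \<le> N \<Longrightarrow>
      \<bar>exp_coeff a m u\<bar> \<le> A2 * exp (c0 / 8 * u)"
    using abs_exp_coeff_le[of "c0 / 8" N B] c0 by auto
  define K where "K = A1 + 1 + K1 + real (N + 1) * A2"
  have "\<bar>exp (- u * ((\<Sum>j\<le>N. a j * \<rho> ^ j) + e)) * ((\<Sum>j\<le>N. b j * \<rho> ^ j) + e') - laplace_model N a b \<rho> u\<bar>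
      \<le> K * (\<epsilon> + \<rho>) * \<rho> ^ N * (1 + (\<Sum>j\<le>N. \<bar>b j\<bar>)) * exp (- (c0 / 8) * u)"
    if a0: "c0 \<le> a 0" and a: "\<forall>j\<le>N. \<bar>a j\<bar> \<le> B" and \<rho>: "0 < \<rho>" "\<rho> < \<delta>" and u: "0 \<le> u"
      and \<epsilon>: "\<epsilon> \<le> c0 / 4" and e: "\<bar>e\<bar> \<le> \<epsilon> * \<rho> ^ N" and e': "\<bar>e'\<bar> \<le> \<epsilon> * \<rho> ^ N"
    for a b \<rho> u \<epsilon> e e'
  proof -
    define P where "P = (\<Sum>j\<le>N. a j * \<rho> ^ j)"
    define G where "G = (\<Sum>j\<le>N. b j * \<rho> ^ j)"
    define S where "S = (\<Sum>j\<le>N. \<bar>b j\<bar>)"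
    define E where "E = (\<Sum>m\<le>N. exp_coeff a m u * \<rho> ^ m)"
    define X where "X = exp (- (c0 / 8) * u)"
    define W where "W = (\<epsilon> + \<rho>) * \<rho> ^ N * (1 + S) * X"
    have \<rho>1: "0 \<le> \<rho>" "\<rho> \<le> 1" using \<rho> \<delta> by auto
    have \<rho>N: "0 < \<rho> ^ N" "\<rho> ^ N \<le> 1" using \<rho> \<rho>1 by (auto simp: power_le_one)
    have \<epsilon>0: "0 \<le> \<epsilon>" using e \<rho>N by (smt (verit) mult_neg_pos)
    have S: "0 \<le> S" by (simp add: S_def sum_nonneg)
    have X: "0 < X" by (simp add: X_def)
    have GS: "\<bar>G\<bar> \<le> S"
    proof -
      have "\<bar>G\<bar> \<le> (\<Sum>j\<le>N. \<bar>b j * \<rho> ^ j\<bar>)" unfolding G_def by (rule sum_abs)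
      also have "\<dots> \<le> S" unfolding S_def
        using \<rho>1 by (intro sum_mono) (auto simp: abs_mult power_le_one intro: mult_left_le)
      finally show ?thesis .
    qed
    have P: "c0 / 2 \<le> P" and tr: "\<bar>exp (- u * P) - exp (- u * a 0) * E\<bar>
             \<le> K1 * \<rho> ^ (N + 1) * exp (- (c0 / 4) * u)"
      using trunc[OF a0 a \<rho> u] by (simp_all add: P_def E_def)
    have "\<epsilon> * \<rho> ^ N \<le> \<epsilon> * 1" using \<epsilon>0 \<rho>N by (intro mult_left_mono) auto
    then have Pe: "c0 / 4 \<le> P + e" using P e \<epsilon> by linarith
    have X4: "exp (- (c0 / 4) * u) = X * X"
      unfolding X_def exp_add[symmetric] by (simp add: field_simps)
    have X1: "X \<le> 1" using c0 u by (simp add: X_def)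
    have XX: "X * X \<le> X" using X X1 by (simp add: mult_left_le)
    have uX: "u * X \<le> A1"
      using A1(2)[of u 1] u by (simp add: X_def exp_minus field_simps)
    have "\<bar>exp (- u * (P + e)) - exp (- u * P)\<bar> \<le> \<bar>- u * (P + e) - - u * P\<bar> * exp (- (c0 / 4) * u)"
    proof (rule abs_exp_diff_le)
      show "- u * (P + e) \<le> - (c0 / 4) * u" using mult_left_mono[OF Pe u] by (simp add: mult_ac)
      have "c0 / 4 \<le> P" using P c0 by simp
      then show "- u * P \<le> - (c0 / 4) * u" using mult_left_mono[of "c0 / 4" P u] u by (simp add: mult_ac)
    qed
    also have "\<dots> = (u * X) * \<bar>e\<bar> * X"
      using u unfolding X4 by (simp add: algebra_simps abs_mult)
    also have "\<dots> \<le> A1 * (\<epsilon> * \<rho> ^ N) * X"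
      using A1(1) uX e X \<epsilon>0 \<rho>N by (intro mult_right_mono mult_mono) auto
    finally have "\<bar>(exp (- u * (P + e)) - exp (- u * P)) * G\<bar> \<le> (A1 * (\<epsilon> * \<rho> ^ N) * X) * S"
      unfolding abs_mult using GS A1(1) X \<epsilon>0 \<rho>N by (intro mult_mono) auto
    also have "\<dots> \<le> A1 * W"
    proof -
      have "\<epsilon> * \<rho> ^ N * X * S \<le> (\<epsilon> + \<rho>) * \<rho> ^ N * X * (1 + S)"
        using \<epsilon>0 \<rho>1 \<rho>N X S by (intro mult_mono) auto
      then show ?thesis using A1(1) by (simp add: W_def mult_ac)
    qed
    finally have t1: "\<bar>(exp (- u * (P + e)) - exp (- u * P)) * G\<bar> \<le> A1 * W" .
    have "exp (- u * (P + e)) \<le> exp (- (c0 / 4) * u)"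
      using Pe u mult_right_mono[OF Pe u] by (simp add: mult_ac)
    then have "exp (- u * (P + e)) \<le> X" unfolding X4 using XX by linarith
    then have "\<bar>exp (- u * (P + e)) * e'\<bar> \<le> X * (\<epsilon> * \<rho> ^ N)"
      unfolding abs_mult using e' X by (intro mult_mono) auto
    also have "\<dots> \<le> W"
    proof -
      have "\<epsilon> * \<rho> ^ N * X * 1 \<le> (\<epsilon> + \<rho>) * \<rho> ^ N * X * (1 + S)"
        using \<epsilon>0 \<rho>1 \<rho>N X S by (intro mult_mono) auto
      then show ?thesis by (simp add: W_def mult_ac)
    qed
    finally have t2: "\<bar>exp (- u * (P + e)) * e'\<bar> \<le> W" .
    have W2: "\<rho> ^ (N + 1) * X * S \<le> W"
    proof -
      have "\<rho> * \<rho> ^ N * X * S \<le> (\<epsilon> + \<rho>) * \<rho> ^ N * X * (1 + S)"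
        using \<epsilon>0 \<rho>1 \<rho>N X S by (intro mult_mono) auto
      then show ?thesis by (simp add: W_def mult_ac)
    qed
    have "\<bar>(exp (- u * P) - exp (- u * a 0) * E) * G\<bar> \<le> (K1 * \<rho> ^ (N + 1) * X) * S"
    proof -
      have "K1 * \<rho> ^ (N + 1) * exp (- (c0 / 4) * u) \<le> K1 * \<rho> ^ (N + 1) * X"
        unfolding X4 using XX K1 \<rho>1 by (intro mult_left_mono) auto
      then show ?thesis
        unfolding abs_mult using tr GS K1 X \<rho>1 by (intro mult_mono) auto
    qed
    also have "\<dots> \<le> K1 * W" using mult_left_mono[OF W2 K1] by (simp add: mult_ac)
    finally have t3: "\<bar>(exp (- u * P) - exp (- u * a 0) * E) * G\<bar> \<le> K1 * W" .
    have "\<bar>E * G - (\<Sum>j\<le>N. (\<Sum>m\<le>j. exp_coeff a m u * b (j - m)) * \<rho> ^ j)\<bar>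
        \<le> (\<Sum>m\<le>N. \<bar>exp_coeff a m u\<bar>) * S * \<rho> ^ (N + 1)"
      unfolding E_def G_def S_def using truncated_product_bound[OF \<rho>1] .
    also have "\<dots> \<le> (\<Sum>m\<le>N. A2 * exp (c0 / 8 * u)) * S * \<rho> ^ (N + 1)"
      using A2 a u S \<rho>1 by (intro mult_right_mono sum_mono) auto
    finally have EG: "\<bar>E * G - (\<Sum>j\<le>N. (\<Sum>m\<le>j. exp_coeff a m u * b (j - m)) * \<rho> ^ j)\<bar>
        \<le> (real (N + 1) * A2 * (S * \<rho> ^ (N + 1))) * exp (c0 / 8 * u)"
      by (simp add: mult_ac)
    have "\<bar>exp (- u * a 0) * (E * G - (\<Sum>j\<le>N. (\<Sum>m\<le>j. exp_coeff a m u * b (j - m)) * \<rho> ^ j))\<bar>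
        \<le> exp (- (c0 / 4) * u) * ((real (N + 1) * A2 * (S * \<rho> ^ (N + 1))) * exp (c0 / 8 * u))"
    proof -
      have "c0 / 4 * u \<le> a 0 * u" using a0 c0 u by (intro mult_right_mono) auto
      then show ?thesis
        unfolding abs_mult
        using EG by (intro mult_mono) (auto simp: mult.commute)
    qed
    also have "\<dots> = real (N + 1) * A2 * (\<rho> ^ (N + 1) * X * S)"
    proof -
      have "exp (- (c0 / 4) * u) * exp (c0 / 8 * u) = X"
        unfolding X_def exp_add[symmetric] by (simp add: field_simps)
      then show ?thesis by (simp add: mult_ac)
    qed
    also have "\<dots> \<le> real (N + 1) * A2 * W" using W2 A2(1) by (intro mult_left_mono) auto
    finally have t4: "\<bar>exp (- u * a 0) * E * G - laplace_model N a b \<rho> u\<bar> \<le> real (N + 1) * A2 * W"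
      by (simp add: laplace_model_def right_diff_distrib mult.assoc)
    have "exp (- u * (P + e)) * (G + e') - laplace_model N a b \<rho> u
        = (exp (- u * (P + e)) - exp (- u * P)) * G + exp (- u * (P + e)) * e'
          + (exp (- u * P) - exp (- u * a 0) * E) * G
          + (exp (- u * a 0) * E * G - laplace_model N a b \<rho> u)"
      by (simp add: algebra_simps)
    then have "\<bar>exp (- u * (P + e)) * (G + e') - laplace_model N a b \<rho> u\<bar>
        \<le> A1 * W + W + K1 * W + real (N + 1) * A2 * W"
      using t1 t2 t3 t4 by linarith
    also have "\<dots> = K * W" by (simp add: K_def algebra_simps)
    finally show ?thesis by (simp add: W_def X_def P_def G_def S_def mult_ac)
  qed
  moreover have "0 \<le> K" using A1(1) A2(1) K1 by (simp add: K_def)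
  ultimately show ?thesis using \<delta> by blast
qed

lemma abs_laplace_model_le:
  fixes c0 B :: real
  assumes c0: "0 < c0"
  shows "\<exists>K\<ge>0. \<forall>a b \<rho> u. c0 \<le> a 0 \<longrightarrow> (\<forall>j\<le>N. \<bar>a j\<bar> \<le> B) \<longrightarrow> 0 \<le> \<rho> \<longrightarrow> 0 \<le> u \<longrightarrow>
           \<bar>laplace_model N a b \<rho> u\<bar>
             \<le> K * (\<Sum>j\<le>N. \<rho> ^ j) * (\<Sum>j\<le>N. \<bar>b j\<bar>) * exp (- (c0 / 8) * u)"
proof -
  obtain A2 where A2: "A2 \<ge> 0" "\<And>a u m. (\<forall>j\<le>N. \<bar>a j\<bar> \<le> B) \<Longrightarrow> 0 \<le> u \<Longrightarrow> m \<le> N \<Longrightarrow>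
      \<bar>exp_coeff a m u\<bar> \<le> A2 * exp (c0 / 8 * u)"
    using abs_exp_coeff_le[of "c0 / 8" N B] c0 by auto
  have "\<bar>laplace_model N a b \<rho> u\<bar> \<le> A2 * (\<Sum>j\<le>N. \<rho> ^ j) * (\<Sum>j\<le>N. \<bar>b j\<bar>) * exp (- (c0 / 8) * u)"
    if a0: "c0 \<le> a 0" and a: "\<forall>j\<le>N. \<bar>a j\<bar> \<le> B" and \<rho>: "0 \<le> \<rho>" and u: "0 \<le> u" for a b \<rho> u
  proof -
    define S where "S = (\<Sum>j\<le>N. \<bar>b j\<bar>)"
    have inner: "\<bar>\<Sum>m\<le>j. exp_coeff a m u * b (j - m)\<bar> \<le> A2 * exp (c0 / 8 * u) * S" if "j \<le> N" for j
    proof -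
      have "\<bar>\<Sum>m\<le>j. exp_coeff a m u * b (j - m)\<bar> \<le> (\<Sum>m\<le>j. \<bar>exp_coeff a m u * b (j - m)\<bar>)"
        by (rule sum_abs)
      also have "\<dots> \<le> (\<Sum>m\<le>j. A2 * exp (c0 / 8 * u) * \<bar>b (j - m)\<bar>)"
        unfolding abs_mult using A2 a u that by (intro sum_mono mult_right_mono) auto
      also have "\<dots> = A2 * exp (c0 / 8 * u) * (\<Sum>m\<le>j. \<bar>b m\<bar>)"
        unfolding sum_distrib_left
        by (rule sum.reindex_bij_witness[of _ "\<lambda>i. j - i" "\<lambda>i. j - i"]) auto
      also have "\<dots> \<le> A2 * exp (c0 / 8 * u) * S"
        unfolding S_def using A2(1) that by (intro mult_left_mono sum_mono2) auto
      finally show ?thesis .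
    qed
    have "\<bar>\<Sum>j\<le>N. (\<Sum>m\<le>j. exp_coeff a m u * b (j - m)) * \<rho> ^ j\<bar>
        \<le> (\<Sum>j\<le>N. \<bar>(\<Sum>m\<le>j. exp_coeff a m u * b (j - m)) * \<rho> ^ j\<bar>)" by (rule sum_abs)
    also have "\<dots> \<le> (\<Sum>j\<le>N. (A2 * exp (c0 / 8 * u) * S) * \<rho> ^ j)"
      unfolding abs_mult using \<rho> inner by (intro sum_mono mult_mono) (auto intro: order_trans[OF abs_ge_zero])
    also have "\<dots> = (A2 * exp (c0 / 8 * u) * S) * (\<Sum>j\<le>N. \<rho> ^ j)" by (simp add: sum_distrib_left)
    finally have s: "\<bar>\<Sum>j\<le>N. (\<Sum>m\<le>j. exp_coeff a m u * b (j - m)) * \<rho> ^ j\<bar>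
        \<le> (A2 * exp (c0 / 8 * u) * S) * (\<Sum>j\<le>N. \<rho> ^ j)" .
    have "c0 / 4 * u \<le> a 0 * u" using a0 c0 u by (intro mult_right_mono) auto
    then have "exp (- u * a 0) \<le> exp (- (c0 / 4) * u)" by (simp add: mult.commute)
    then have "\<bar>laplace_model N a b \<rho> u\<bar>
        \<le> exp (- (c0 / 4) * u) * ((A2 * exp (c0 / 8 * u) * S) * (\<Sum>j\<le>N. \<rho> ^ j))"
      unfolding laplace_model_def abs_mult using s by (intro mult_mono) auto
    also have "\<dots> = A2 * (\<Sum>j\<le>N. \<rho> ^ j) * S * (exp (- (c0 / 4) * u) * exp (c0 / 8 * u))"
      by (simp add: mult_ac)
    also have "exp (- (c0 / 4) * u) * exp (c0 / 8 * u) = exp (- (c0 / 8) * u)"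
      unfolding exp_add[symmetric] by (simp add: field_simps)
    finally show ?thesis unfolding S_def .
  qed
  then show ?thesis using A2(1) by blast
qed

section \<open>Polar coordinates\<close>

text \<open>
  Product measures and Fubini's theorem are applied to the surface measure before
  completion; results are transferred to \<open>sphere_measure\<close>, and from \<open>lborel\<close> to \<open>lebesgue\<close>, by
  changing functions on null sets.
\<close>

definition sphere_borel_measure :: "'a::euclidean_space measure" where
  "sphere_borel_measure =
     distr (scale_measure (of_nat DIM('a)) (restrict_space lborel (ball 0 1 - {0})))
           (restrict_space borel (sphere 0 1)) (\<lambda>x. x /\<^sub>R norm x)"

lemma sphere_measure_eq_completion: "sphere_measure = completion sphere_borel_measure"
  by (simp add: sphere_measure_def sphere_borel_measure_def)

lemma sets_sphere_borel_measure [simp, measurable_cong]: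
  "sets (sphere_borel_measure :: 'a::euclidean_space measure) = sets (restrict_space borel (sphere 0 1))"
  by (simp add: sphere_borel_measure_def)

lemma space_sphere_borel_measure [simp]:
  "space (sphere_borel_measure :: 'a::euclidean_space measure) = sphere 0 1"
  by (simp add: sphere_borel_measure_def space_restrict_space)

lemma space_sphere_measure: "space (sphere_measure :: 'a::euclidean_space measure) = sphere 0 1"
  by (simp add: sphere_measure_eq_completion)

lemma emeasure_sphere_borel_measure:
  fixes B :: "'a::euclidean_space set"
  assumes "B \<in> sets (restrict_space borel (sphere 0 1))"
  shows "emeasure sphere_borel_measure B =
           of_nat DIM('a) * emeasure lborel {x. 0 < norm x \<and> norm x < 1 \<and> x /\<^sub>R norm x \<in> B}"
proof -
  have "B \<in> sets borel" "B \<subseteq> sphere 0 1" using assms by (auto simp: sets_restrict_space_iff)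
  then have "emeasure sphere_measure B =
           of_nat DIM('a) * emeasure lborel {x. 0 < norm x \<and> norm x < 1 \<and> x /\<^sub>R norm x \<in> B}"
    by (rule emeasure_sphere_measure)
  moreover have "emeasure (completion sphere_borel_measure) B = emeasure sphere_borel_measure B"
    using assms by simp
  ultimately show ?thesis
    using assms by (simp add: sphere_measure_eq_completion)
qed

lemma finite_measure_sphere_borel_measure:
  "finite_measure (sphere_borel_measure :: 'a::euclidean_space measure)"
proof
  let ?S = "{x::'a. 0 < norm x \<and> norm x < 1 \<and> x /\<^sub>R norm x \<in> sphere 0 1}"
  have "emeasure lborel ?S \<le> emeasure lborel (ball (0::'a) 1)"
    by (intro emeasure_mono) auto
  also have "\<dots> < \<infinity>" by (rule emeasure_lborel_ball_finite)
  finally have "emeasure lborel ?S < \<infinity>" .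
  moreover have "sphere 0 1 \<in> sets (restrict_space borel (sphere (0::'a) 1))"
    by (simp add: sets_restrict_space_iff)
  ultimately show "emeasure sphere_borel_measure (space sphere_borel_measure :: 'a set) \<noteq> \<infinity>"
    by (simp add: emeasure_sphere_borel_measure ennreal_mult_eq_top_iff del: mem_sphere)
qed

definition radial_measure :: "nat \<Rightarrow> real measure" where
  "radial_measure d = density lborel (\<lambda>r. ennreal (indicator {0<..} r * r ^ (d - 1)))"

lemma sets_radial_measure [simp, measurable_cong]: "sets (radial_measure d) = sets borel"
  by (simp add: radial_measure_def)

lemma space_radial_measure [simp]: "space (radial_measure d) = UNIV"
  by (simp add: radial_measure_def)

lemma sigma_finite_radial_measure: "sigma_finite_measure (radial_measure d)"
  unfolding radial_measure_def
  by (subst sigma_finite_measure.sigma_finite_iff_density_finite[OF sigma_finite_lborel]) auto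

text \<open>
  At \<open>0\<close> the direction is an arbitrary fixed unit vector, so that the polar map is
  defined on the whole space with values in the sphere.
\<close>

definition unit_vector :: "'a::euclidean_space \<Rightarrow> 'a" where
  "unit_vector x = (if x = 0 then SOME i. i \<in> Basis else x /\<^sub>R norm x)"

lemma norm_unit_vector [simp]: "norm (unit_vector x) = 1"
  using some_in_eq[of "Basis::'a set"] by (auto simp: unit_vector_def)

lemma norm_scaleR_unit_vector: "norm x *\<^sub>R unit_vector x = x"
  by (cases "x = 0") (auto simp: unit_vector_def)

lemma unit_vector_measurable [measurable]:
  "unit_vector \<in> borel \<rightarrow>\<^sub>M restrict_space borel (sphere (0::'a::euclidean_space) 1)"
proof (rule measurable_restrict_space2)
  show "(unit_vector :: 'a \<Rightarrow> 'a) \<in> borel_measurable borel"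
    unfolding unit_vector_def[abs_def] by measurable
qed auto

definition polar :: "'a::euclidean_space \<Rightarrow> 'a \<times> real" where
  "polar x = (unit_vector x, norm x)"

lemma polar_measurable [measurable]:
  "polar \<in> borel \<rightarrow>\<^sub>M restrict_space borel (sphere (0::'a::euclidean_space) 1) \<Otimes>\<^sub>M borel"
  unfolding polar_def[abs_def] by measurable

lemma emeasure_lborel_scaled_cone:
  fixes B :: "'a::euclidean_space set"
  assumes B: "B \<in> sets (restrict_space borel (sphere 0 1))" and b: "0 < b"
  shows "emeasure lborel {x. 0 < norm x \<and> norm x < b \<and> unit_vector x \<in> B} =
           ennreal (b ^ DIM('a)) * emeasure lborel {x. 0 < norm x \<and> norm x < 1 \<and> x /\<^sub>R norm x \<in> B}"
proof -
  let ?C = "\<lambda>b. {x::'a. 0 < norm x \<and> norm x < b \<and> unit_vector x \<in> B}"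
  have meas: "?C c \<in> sets borel" for c
  proof -
    have "?C c = unit_vector -` B \<inter> space borel \<inter> {x. 0 < norm x \<and> norm x < c}" by auto
    also have "\<dots> \<in> sets borel"
      using measurable_sets[OF unit_vector_measurable B] by (intro sets.Int) auto
    finally show ?thesis .
  qed
  have eq: "?C b = (\<lambda>x. b *\<^sub>R x + 0) ` ?C 1"
  proof (intro equalityI subsetI)
    fix x assume x: "x \<in> ?C b"
    then have "inverse b *\<^sub>R x \<in> ?C 1"
      using b by (auto simp: unit_vector_def field_simps)
    then show "x \<in> (\<lambda>x. b *\<^sub>R x + 0) ` ?C 1"
      using b by (intro image_eqI[of _ _ "inverse b *\<^sub>R x"]) auto
  next
    fix x assume "x \<in> (\<lambda>x. b *\<^sub>R x + 0) ` ?C 1"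
    then show "x \<in> ?C b" using b by (auto simp: unit_vector_def field_simps)
  qed
  have 1: "emeasure lebesgue (?C b) = ennreal (b ^ DIM('a)) * emeasure lebesgue (?C 1)"
    unfolding eq using emeasure_lebesgue_affine[of b 0 "?C 1"] b by (simp add: ennreal_power)
  have 2: "?C 1 = {x. 0 < norm x \<and> norm x < 1 \<and> x /\<^sub>R norm x \<in> B}"
    by (auto simp: unit_vector_def)
  have 3: "emeasure lebesgue (?C c) = emeasure lborel (?C c)" for c
    using meas[of c] by (intro emeasure_completion[THEN trans]) auto
  show ?thesis using 1 unfolding 3 unfolding 2 .
qed

lemma Int_lessThan_min: "{..<a} \<inter> {..<b} = {..<min a b :: real}"
  by auto

lemma emeasure_radial_measure_lessThan:
  assumes "0 < d"
  shows "emeasure (radial_measure d) {..<b} = ennreal (max b 0 ^ d / d)"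
proof -
  have "((\<lambda>r. r ^ (d - 1)) has_integral (max b 0 ^ d / d - 0 ^ d / d)) {0..max b 0}"
    using assms
    by (intro fundamental_theorem_of_calculus)
       (auto intro!: derivative_eq_intros simp flip: has_real_derivative_iff_has_vector_derivative)
  then have "((\<lambda>r. r ^ (d - 1)) has_integral (max b 0 ^ d / d)) {0..max b 0}"
    using assms by (simp add: zero_power)
  then have "(\<integral>\<^sup>+ r. ennreal (indicator {0..max b 0} r * r ^ (d - 1)) \<partial>lborel) = ennreal (max b 0 ^ d / d)"
    by (intro nn_integral_has_integral_lebesgue) auto
  moreover have "emeasure (radial_measure d) {..<b}
      = (\<integral>\<^sup>+ r. ennreal (indicator {0..max b 0} r * r ^ (d - 1)) \<partial>lborel)"
    unfolding radial_measure_def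
  proof (subst emeasure_density, simp, simp, rule nn_integral_cong_AE)
    have "AE r in lborel. r \<noteq> 0 \<and> r \<noteq> (max b 0)" by (simp add: AE_lborel_singleton)
    then show "AE r in lborel. ennreal (indicator {0<..} r * r ^ (d - 1)) * indicator {..<b} r
        = ennreal (indicator {0..max b 0} r * r ^ (d - 1))"
      by eventually_elim (auto simp: indicator_def)
  qed
  ultimately show ?thesis by simp
qed

text \<open>
  It suffices to compare the measures of rectangles \<open>B \<times> A\<close>.  The set of \<open>x\<close> with direction in \<open>B\<close>
  and \<open>0 < norm x < b\<close> is the cone over \<open>B\<close> scaled by \<open>b\<close>, so its volume is \<open>b ^ d\<close> times that of the
  cone; the definition of the surface measure through cones does the rest.
\<close>

theorem distr_polar:
  "distr lborel (restrict_space borel (sphere 0 1) \<Otimes>\<^sub>M borel) (polar :: 'a::euclidean_space \<Rightarrow> _) =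
     sphere_borel_measure \<Otimes>\<^sub>M radial_measure DIM('a)"
proof (rule pair_measure_eqI[symmetric])
  let ?S = "restrict_space borel (sphere (0::'a) 1)"
  interpret fin: finite_measure "sphere_borel_measure :: 'a measure"
    by (rule finite_measure_sphere_borel_measure)
  show "sigma_finite_measure (sphere_borel_measure :: 'a measure)" ..
  show "sigma_finite_measure (radial_measure DIM('a))" by (rule sigma_finite_radial_measure)
  show "sets (sphere_borel_measure \<Otimes>\<^sub>M radial_measure DIM('a)) = sets (distr lborel (?S \<Otimes>\<^sub>M borel) polar)"
    by (simp cong: sets_pair_measure_cong)
  fix B :: "'a set" and A :: "real set"
  assume "B \<in> sets sphere_borel_measure" "A \<in> sets (radial_measure DIM('a))"
  then have B: "B \<in> sets ?S" and A: "A \<in> sets borel" by simp_all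
  have Bm: "unit_vector -` B \<in> sets borel" using measurable_sets[OF unit_vector_measurable B] by simp
  \<comment> \<open>For fixed \<open>B\<close> both sides are measures in \<open>A\<close>; they agree on half-lines by homogeneity.\<close>
  define M where "M = distr (density lborel (indicator (unit_vector -` B))) borel (norm :: 'a \<Rightarrow> real)"
  define M' where "M' = scale_measure (emeasure sphere_borel_measure B) (radial_measure DIM('a))"
  have emM: "emeasure M X = emeasure lborel {x. norm x \<in> X \<and> unit_vector x \<in> B}" if "X \<in> sets borel" for X
  proof -
    have "norm -` X \<in> sets (borel :: 'a measure)"
      using measurable_sets[OF borel_measurable_norm that] by simp
    then have "emeasure M X = (\<integral>\<^sup>+ x. indicator (unit_vector -` B) x * indicator (norm -` X) x \<partial>lborel)"
      unfolding M_def using that Bm by (subst emeasure_distr) (auto simp: emeasure_density)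
    also have "\<dots> = (\<integral>\<^sup>+ x. indicator (unit_vector -` B \<inter> norm -` X) x \<partial>lborel)"
      by (simp add: indicator_inter_arith)
    also have "\<dots> = emeasure lborel (unit_vector -` B \<inter> norm -` X)"
      using \<open>norm -` X \<in> _\<close> Bm by (intro nn_integral_indicator) auto
    finally show ?thesis by (simp add: vimage_def Int_def conj_commute)
  qed
  have "M = M'"
  proof (rule measure_eqI_generator_eq[where E = "range lessThan" and \<Omega> = UNIV and A = "\<lambda>n. {..<real n}"])
    show "Int_stable (range lessThan :: real set set)"
      by (simp add: Int_stable_def Int_lessThan_min)
    show "sets M = sigma_sets UNIV (range lessThan)" "sets M' = sigma_sets UNIV (range lessThan)"
      by (simp_all add: M_def M'_def borel_Iio)
    show "(\<Union>n. {..<real n}) = UNIV" by (auto intro: reals_Archimedean2)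
    have half: "emeasure M {..<b} = emeasure M' {..<b}" for b
    proof (cases "0 < b")
      case False
      have empty: "{x::'a. norm x \<in> {..<b} \<and> unit_vector x \<in> B} = {}"
      proof -
        have "\<not> norm x < b" for x :: 'a using False norm_ge_zero[of x] by linarith
        then show ?thesis by simp
      qed
      have "emeasure M {..<b} = 0"
        using emM[of "{..<b}"] unfolding empty by simp
      moreover have "emeasure M' {..<b} = 0"
        using False by (simp add: M'_def emeasure_radial_measure_lessThan max_def zero_power)
      ultimately show ?thesis by simp
    next
      case True
      let ?C = "{x::'a. 0 < norm x \<and> norm x < 1 \<and> x /\<^sub>R norm x \<in> B}"
      have "emeasure lborel {x::'a. norm x \<in> {..<b} \<and> unit_vector x \<in> B}
          = emeasure lborel {x::'a. 0 < norm x \<and> norm x < b \<and> unit_vector x \<in> B}"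
      proof (rule emeasure_eq_AE)
        show "AE x in lborel. x \<in> {x::'a. norm x \<in> {..<b} \<and> unit_vector x \<in> B} \<longleftrightarrow>
            x \<in> {x. 0 < norm x \<and> norm x < b \<and> unit_vector x \<in> B}"
          using AE_lborel_singleton[of "0::'a"] by eventually_elim auto
        have "{x::'a. norm x \<in> {..<b} \<and> unit_vector x \<in> B} = norm -` {..<b} \<inter> unit_vector -` B"
          "{x::'a. 0 < norm x \<and> norm x < b \<and> unit_vector x \<in> B} = norm -` {0<..<b} \<inter> unit_vector -` B"
          by auto
        moreover have "norm -` {..<b} \<in> sets (borel :: 'a measure)" "norm -` {0<..<b} \<in> sets (borel :: 'a measure)"
          using measurable_sets[OF borel_measurable_norm[where 'a='a], of "{..<b}"]
            measurable_sets[OF borel_measurable_norm[where 'a='a], of "{0<..<b}"]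
          by auto
        ultimately show "{x::'a. norm x \<in> {..<b} \<and> unit_vector x \<in> B} \<in> sets lborel"
          "{x::'a. 0 < norm x \<and> norm x < b \<and> unit_vector x \<in> B} \<in> sets lborel"
          using Bm by auto
      qed
      also have "\<dots> = ennreal (b ^ DIM('a)) * emeasure lborel ?C"
        by (rule emeasure_lborel_scaled_cone[OF B True])
      also have "\<dots> = (of_nat DIM('a) * emeasure lborel ?C) * ennreal (b ^ DIM('a) / DIM('a))"
      proof -
        have "ennreal (b ^ DIM('a)) = ennreal (real DIM('a)) * ennreal (b ^ DIM('a) / DIM('a))"
          using True by (subst ennreal_mult[symmetric]) auto
        then show ?thesis by (simp add: ennreal_of_nat_eq_real_of_nat mult_ac)
      qed
      finally show ?thesis
        using True by (simp add: emM M'_def emeasure_radial_measure_lessThan emeasure_sphere_borel_measure[OF B])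
    qed
    then show "\<And>X. X \<in> range lessThan \<Longrightarrow> emeasure M X = emeasure M' X" by auto
    fix n
    show "emeasure M {..<real n} \<noteq> \<infinity>"
      unfolding half using fin.emeasure_finite[of B]
      by (simp add: M'_def emeasure_radial_measure_lessThan ennreal_mult_eq_top_iff)
  qed auto
  then have "emeasure sphere_borel_measure B * emeasure (radial_measure DIM('a)) A
      = emeasure lborel {x. norm x \<in> A \<and> unit_vector x \<in> B}"
    using emM[OF A] by (simp add: M'_def)
  also have "\<dots> = emeasure (distr lborel (?S \<Otimes>\<^sub>M borel) polar) (B \<times> A)"
    using A B by (subst emeasure_distr) (auto simp: polar_def vimage_def intro!: arg_cong[where f="emeasure lborel"])
  finally show "emeasure sphere_borel_measure B * emeasure (radial_measure DIM('a)) A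
      = emeasure (distr lborel (?S \<Otimes>\<^sub>M borel) polar) (B \<times> A)" .
qed

lemma borel_measurable_completionI_AE:
  fixes f f' :: "'a \<Rightarrow> real"
  assumes f': "f' \<in> borel_measurable M" and ae: "AE x in M. f x = f' x"
  shows "f \<in> borel_measurable (completion M)"
proof (rule measurableI)
  fix A :: "real set" assume A: "A \<in> sets borel"
  show "f -` A \<inter> space (completion M) \<in> sets (completion M)"
  proof (rule completion.in_sets_AE)
    show "AE x in completion M. x \<in> f' -` A \<inter> space M \<longleftrightarrow> x \<in> f -` A \<inter> space (completion M)"
      using AE_completion[OF ae] by eventually_elim auto
    show "f' -` A \<inter> space M \<in> sets (completion M)"
      using measurable_sets[OF f' A] by simp
  qed auto
qed simp

lemma has_bochner_integral_completionI_AE: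
  fixes f f' :: "'a \<Rightarrow> real"
  assumes f': "has_bochner_integral M f' I" and ae: "AE x in M. f x = f' x"
  shows "has_bochner_integral (completion M) f I"
proof -
  have m: "f' \<in> borel_measurable M" using f' by (simp add: has_bochner_integral_iff borel_measurable_integrable)
  have "has_bochner_integral (completion M) f' I"
    using f' m by (simp add: has_bochner_integral_iff integrable_completion integral_completion)
  moreover have "f \<in> borel_measurable (completion M)"
    by (rule borel_measurable_completionI_AE[OF m ae])
  ultimately show ?thesis
    using has_bochner_integral_cong_AE[of f "completion M" f' I] AE_completion[OF ae] m
    by (simp add: measurable_completion)
qed

lemma integrable_completionD_AE:
  fixes f :: "'a \<Rightarrow> real"
  assumes f: "integrable (completion M) f"
  obtains f' where "integrable M f'" "AE x in M. f x = f' x"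
    "integral\<^sup>L M f' = integral\<^sup>L (completion M) f"
proof -
  obtain f' where m: "f' \<in> borel_measurable M" and ae: "AE x in M. f x = f' x"
    using completion_ex_borel_measurable_real[OF borel_measurable_integrable[OF f]] by blast
  have ae': "AE x in completion M. f x = f' x" by (rule AE_completion[OF ae])
  have mc: "f' \<in> borel_measurable (completion M)" using m by (rule measurable_completion)
  have "integrable (completion M) f'"
    using integrable_cong_AE[OF borel_measurable_integrable[OF f] mc ae'] f by simp
  then have "integrable M f'" using m by (simp add: integrable_completion)
  moreover have "integral\<^sup>L M f' = integral\<^sup>L (completion M) f"
    using integral_cong_AE[OF borel_measurable_integrable[OF f] mc ae'] m by (simp add: integral_completion)
  ultimately show thesis using that ae by blast
qed

lemma pair_sigma_finite_polar:
  "pair_sigma_finite (sphere_borel_measure :: 'a::euclidean_space measure) (radial_measure d)"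
proof -
  interpret finite_measure "sphere_borel_measure :: 'a measure"
    by (rule finite_measure_sphere_borel_measure)
  show ?thesis
    by (intro pair_sigma_finite.intro sigma_finite_radial_measure) unfold_locales
qed

lemma AE_unit_vector:
  fixes P :: "'a::euclidean_space \<Rightarrow> bool"
  assumes "AE \<omega> in sphere_borel_measure. P \<omega>"
  shows "AE x in lborel. P (unit_vector x)"
proof -
  interpret pair_sigma_finite "sphere_borel_measure :: 'a measure" "radial_measure DIM('a)"
    by (rule pair_sigma_finite_polar)
  obtain Z where Z: "Z \<in> null_sets sphere_borel_measure" and sub: "{\<omega>\<in>space sphere_borel_measure. \<not> P \<omega>} \<subseteq> Z"
    using assms unfolding eventually_ae_filter by auto
  have [measurable]: "Z \<in> sets sphere_borel_measure" using Z by (auto simp: null_sets_def)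
  have meas: "{z \<in> space (sphere_borel_measure \<Otimes>\<^sub>M radial_measure DIM('a)). fst z \<notin> Z}
      \<in> sets (sphere_borel_measure \<Otimes>\<^sub>M radial_measure DIM('a))"
    by measurable
  have "AE z in sphere_borel_measure \<Otimes>\<^sub>M radial_measure DIM('a). fst z \<notin> Z"
    by (rule AE_pair_measure[OF meas]) (use AE_not_in[OF Z] in auto)
  then have "AE z in distr lborel (restrict_space borel (sphere 0 1) \<Otimes>\<^sub>M borel) polar. fst z \<notin> Z"
    unfolding distr_polar .
  then have "AE x in lborel. fst (polar x :: 'a \<times> real) \<notin> Z"
  proof (subst (asm) AE_distr_iff)
    show "{z \<in> space (restrict_space borel (sphere 0 1) \<Otimes>\<^sub>M borel). fst (z :: 'a \<times> real) \<notin> Z}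
        \<in> sets (restrict_space borel (sphere 0 1) \<Otimes>\<^sub>M borel)"
      using meas by (simp add: space_pair_measure space_restrict_space cong: sets_pair_measure_cong)
  qed auto
  then show ?thesis
  proof eventually_elim
    case (elim x)
    show ?case
    proof (rule ccontr)
      assume "\<not> P (unit_vector x)"
      then have "unit_vector x \<in> {\<omega>\<in>space sphere_borel_measure. \<not> P \<omega>}" by simp
      with sub have "unit_vector x \<in> Z" by (rule subsetD)
      with elim show False by (simp add: polar_def)
    qed
  qed
qed

text \<open>
  Fubini's theorem for \<open>distr_polar\<close>, applied to a Borel function that agrees with \<open>h\<close> almost
  everywhere.  The null set on which the two differ meets almost every sphere in a null set.
\<close>

lemma AE_integrable_sphere_slices:
  fixes h :: "'a::euclidean_space \<Rightarrow> real"
  assumes h: "integrable lebesgue h"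
  shows "AE r in lborel. 0 < r \<longrightarrow> integrable sphere_measure (\<lambda>\<omega>. h (r *\<^sub>R \<omega>))"
proof -
  let ?S = "restrict_space borel (sphere (0::'a) 1)"
  let ?\<mu> = "sphere_borel_measure :: 'a measure" and ?\<tau> = "radial_measure DIM('a)"
  interpret pair_sigma_finite ?\<mu> ?\<tau> by (rule pair_sigma_finite_polar)
  interpret Q: pair_sigma_finite ?\<tau> ?\<mu> ..
  obtain h' where h': "integrable lborel h'" and ae: "AE x in lborel. h x = h' x"
    using integrable_completionD_AE[OF h] .
  have h'm[measurable]: "h' \<in> borel_measurable borel" using borel_measurable_integrable[OF h'] by simp
  have id[measurable]: "(\<lambda>x. x) \<in> ?S \<rightarrow>\<^sub>M borel" by (rule measurable_restrict_space1) simp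
  have sc[measurable]: "(\<lambda>z. snd z *\<^sub>R fst z) \<in> ?S \<Otimes>\<^sub>M borel \<rightarrow>\<^sub>M (borel :: 'a measure)"
    using measurable_compose[OF measurable_fst id] by measurable
  have "integrable (distr lborel (?S \<Otimes>\<^sub>M borel) polar) (\<lambda>z. h' (snd z *\<^sub>R fst z))"
    using h' by (subst integrable_distr_eq) (auto simp: polar_def norm_scaleR_unit_vector)
  then have "integrable (?\<mu> \<Otimes>\<^sub>M ?\<tau>) (\<lambda>z. h' (snd z *\<^sub>R fst z))"
    unfolding distr_polar .
  from Q.AE_integrable_fst'[OF integrable_product_swap[OF this]]
  have int: "AE r in ?\<tau>. integrable ?\<mu> (\<lambda>\<omega>. h' (r *\<^sub>R \<omega>))"
    by simp
  obtain Z where Z: "Z \<in> null_sets lborel" and sub: "{x. h x \<noteq> h' x} \<subseteq> Z"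
    using ae unfolding eventually_ae_filter by auto
  have Zm[measurable]: "Z \<in> sets borel" using Z by (auto simp: null_sets_def)
  have meas: "{z \<in> space (?S \<Otimes>\<^sub>M borel). snd z *\<^sub>R fst z \<notin> Z} \<in> sets (?S \<Otimes>\<^sub>M borel)"
    by measurable
  have meas': "{z \<in> space (?\<mu> \<Otimes>\<^sub>M ?\<tau>). snd z *\<^sub>R fst z \<notin> Z} \<in> sets (?\<mu> \<Otimes>\<^sub>M ?\<tau>)"
    using meas by (simp add: space_pair_measure space_restrict_space cong: sets_pair_measure_cong)
  have "AE x in lborel. snd (polar x) *\<^sub>R fst (polar x) \<notin> Z"
    using AE_not_in[OF Z] by (simp add: polar_def norm_scaleR_unit_vector)
  then have "AE z in distr lborel (?S \<Otimes>\<^sub>M borel) polar. snd z *\<^sub>R fst z \<notin> Z"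
    by (subst AE_distr_iff[OF _ meas]) auto
  then have "AE \<omega> in ?\<mu>. AE r in ?\<tau>. r *\<^sub>R \<omega> \<notin> Z"
    unfolding distr_polar by (subst AE_pair_iff[OF meas'])
  then have "AE r in ?\<tau>. AE \<omega> in ?\<mu>. r *\<^sub>R \<omega> \<notin> Z"
    by (subst (asm) AE_commute[OF meas'])
  with int have "AE r in ?\<tau>. integrable sphere_measure (\<lambda>\<omega>. h (r *\<^sub>R \<omega>))"
  proof eventually_elim
    case (elim r)
    have "AE \<omega> in ?\<mu>. h (r *\<^sub>R \<omega>) = h' (r *\<^sub>R \<omega>)"
      using elim(2) sub by (auto elim!: eventually_mono)
    from has_bochner_integral_completionI_AE[OF has_bochner_integral_integrable[OF elim(1)] this]
    show ?case by (simp add: sphere_measure_eq_completion has_bochner_integral_iff)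
  qed
  then show ?thesis
    unfolding radial_measure_def by (subst (asm) AE_density) (auto elim!: eventually_mono)
qed

section \<open>Radial integrals\<close>

text \<open>
  The substitution \<open>t = k * \<phi> * \<rho> powr \<nu>\<close> turns Euler's integral for \<open>Gamma (a / \<nu> + r)\<close> into this
  one.
\<close>

lemma has_bochner_integral_radial:
  fixes a \<nu> k \<phi> :: real
  assumes a: "0 < a" and \<nu>: "0 < \<nu>" and k: "0 < k" and \<phi>: "0 < \<phi>" and d: "0 < d"
  shows "has_bochner_integral (radial_measure d)
      (\<lambda>\<rho>. \<rho> powr (a - real d) * (k * \<rho> powr \<nu>) ^ r * exp (- (k * \<rho> powr \<nu>) * \<phi>))
      (1 / \<nu> * Gamma (a / \<nu> + r) * k powr (- (a / \<nu>)) * \<phi> powr (- (a / \<nu> + r)))"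
proof -
  define s where "s = a / \<nu> + r"
  define c where "c = k * \<phi>"
  define \<gamma> where "\<gamma> t = t powr (s - 1) / exp t" for t :: real
  have s: "0 < s" using a \<nu> by (simp add: s_def add_pos_nonneg)
  have c: "0 < c" using k \<phi> by (simp add: c_def)
  have "(\<gamma> has_integral Gamma s) {0..}"
    unfolding \<gamma>_def by (rule Gamma_integral_real[OF s])
  then have hi: "(\<gamma> has_integral Gamma s) {0<..}"
  proof (rule has_integral_spike_set_eq[THEN iffD1, rotated -1])
    have "{t \<in> {0..} - {0<..}. \<gamma> t \<noteq> 0} = {}" "{t \<in> {0<..} - {0..}. \<gamma> t \<noteq> 0} = {}"
      by (auto simp: \<gamma>_def)
    then show "negligible {t \<in> {0..} - {0<..}. \<gamma> t \<noteq> 0}" "negligible {t \<in> {0<..} - {0..}. \<gamma> t \<noteq> 0}"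
      by (simp_all only: negligible_empty)
  qed
  then have "\<gamma> absolutely_integrable_on {0<..}"
    by (intro nonnegative_absolutely_integrable_1) (auto simp: \<gamma>_def)
  moreover have img: "(\<lambda>\<rho>. c * \<rho> powr \<nu>) ` {0<..} = {0<..}"
  proof (intro equalityI subsetI)
    fix t :: real assume t: "t \<in> {0<..}"
    have "t = c * ((t / c) powr (1 / \<nu>)) powr \<nu>"
      using c t \<nu> by (simp add: powr_powr)
    then show "t \<in> (\<lambda>\<rho>. c * \<rho> powr \<nu>) ` {0<..}"
      using c t by (intro image_eqI[of _ _ "(t / c) powr (1 / \<nu>)"]) auto
  qed (use c in auto)
  moreover have inj: "inj_on (\<lambda>\<rho>. c * \<rho> powr \<nu>) {0<..}"
  proof (rule inj_on_inverseI)
    show "(c * \<rho> powr \<nu> / c) powr (1 / \<nu>) = \<rho>" if "\<rho> \<in> {0<..}" for \<rho>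
      using that c \<nu> by (simp add: powr_powr)
  qed
  ultimately have ai: "(\<lambda>\<rho>. \<bar>c * (\<nu> * \<rho> powr (\<nu> - 1))\<bar> * \<gamma> (c * \<rho> powr \<nu>)) absolutely_integrable_on {0<..}
      \<and> integral {0<..} (\<lambda>\<rho>. \<bar>c * (\<nu> * \<rho> powr (\<nu> - 1))\<bar> * \<gamma> (c * \<rho> powr \<nu>)) = Gamma s"
    using has_integral_integrable_integral[THEN iffD1, OF hi]
    by (subst has_absolute_integral_change_of_variables_1') (auto intro!: derivative_eq_intros)
  define w where "w \<rho> = indicator {0<..} \<rho> *\<^sub>R (\<bar>c * (\<nu> * \<rho> powr (\<nu> - 1))\<bar> * \<gamma> (c * \<rho> powr \<nu>))" for \<rho>
  have wm: "w \<in> borel_measurable borel" unfolding w_def \<gamma>_def by measurable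
  have "integrable lebesgue w" using ai by (simp add: w_def[abs_def] set_integrable_def)
  moreover have "integral\<^sup>L lebesgue w = Gamma s"
    using set_lebesgue_integral_eq_integral[OF conjunct1[OF ai]] ai
    by (simp add: w_def[abs_def] set_lebesgue_integral_def)
  ultimately have "has_bochner_integral lborel w (Gamma s)"
    using wm by (simp add: has_bochner_integral_iff integrable_completion integral_completion)
  then have "has_bochner_integral lborel (\<lambda>\<rho>. (k ^ r / (\<nu> * c powr s)) * w \<rho>) (k ^ r / (\<nu> * c powr s) * Gamma s)"
    by (rule has_bochner_integral_mult_right)
  moreover have "k ^ r / (\<nu> * c powr s) * Gamma s
      = 1 / \<nu> * Gamma (a / \<nu> + r) * k powr (- (a / \<nu>)) * \<phi> powr (- (a / \<nu> + r))"
  proof -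
    have "k ^ r / c powr s = k powr (- (a / \<nu>)) * \<phi> powr (- s)"
    proof -
      have "k powr s = k powr (a / \<nu>) * k ^ r" using k by (simp add: s_def powr_add powr_realpow)
      then show ?thesis using k \<phi> by (simp add: c_def powr_mult powr_minus field_simps)
    qed
    moreover have "k ^ r / (\<nu> * c powr s) * Gamma s = 1 / \<nu> * Gamma s * (k ^ r / c powr s)" by simp
    ultimately show ?thesis by (simp add: s_def mult.assoc)
  qed
  moreover have "(k ^ r / (\<nu> * c powr s)) * w \<rho> = (indicator {0<..} \<rho> * \<rho> ^ (d - 1)) *\<^sub>R
      (\<rho> powr (a - real d) * (k * \<rho> powr \<nu>) ^ r * exp (- (k * \<rho> powr \<nu>) * \<phi>))" for \<rho>
  proof (cases "0 < \<rho>")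
    case True
    have 1: "(c * \<rho> powr \<nu>) powr (s - 1) = c powr s / c * (\<rho> powr a * (\<rho> powr \<nu>) ^ r / \<rho> powr \<nu>)"
    proof -
      have "\<nu> * (s - 1) = a + \<nu> * real r - \<nu>" using \<nu> by (simp add: s_def field_simps)
      then have "(\<rho> powr \<nu>) powr (s - 1) = \<rho> powr (a + \<nu> * real r - \<nu>)"
        by (simp only: powr_powr)
      also have "\<dots> = \<rho> powr a * \<rho> powr (\<nu> * real r) / \<rho> powr \<nu>"
        by (simp only: powr_diff powr_add)
      also have "\<rho> powr (\<nu> * real r) = (\<rho> powr \<nu>) ^ r"
        using True by (simp add: powr_powr[symmetric] powr_realpow)
      finally show ?thesis using c True by (simp add: powr_mult powr_diff[of c s 1])
    qed
    have 2: "\<rho> ^ (d - 1) * \<rho> powr (a - real d) = \<rho> powr a / \<rho>"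
    proof -
      have "\<rho> ^ (d - 1) = \<rho> powr (real d - 1)"
        using True d by (simp add: powr_realpow[symmetric] of_nat_diff)
      then have "\<rho> ^ (d - 1) * \<rho> powr (a - real d) = \<rho> powr ((real d - 1) + (a - real d))"
        by (simp only: powr_add)
      then show ?thesis using True by (simp add: powr_diff)
    qed
    have alg: "K / (\<nu> * C) * (\<bar>c * (\<nu> * (p / \<rho>))\<bar> * (C / c * (q * P / p) / E)) = q / \<rho> * (K * P) / E"
      if "0 < C" "0 < p" for K C p q P E :: real
      using that c \<nu> True by (simp add: abs_mult)
    have "\<rho> powr (\<nu> - 1) = \<rho> powr \<nu> / \<rho>" using True by (simp add: powr_diff)
    then have "(k ^ r / (\<nu> * c powr s)) * w \<rho>
        = (k ^ r / (\<nu> * c powr s)) * (\<bar>c * (\<nu> * (\<rho> powr \<nu> / \<rho>))\<bar> * ((c * \<rho> powr \<nu>) powr (s - 1) / exp (c * \<rho> powr \<nu>)))"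
      using True by (simp add: w_def \<gamma>_def)
    also have "\<dots> = \<rho> powr a / \<rho> * (k ^ r * (\<rho> powr \<nu>) ^ r) / exp (c * \<rho> powr \<nu>)"
      unfolding 1 using True c by (intro alg) auto
    also have "\<dots> = (\<rho> ^ (d - 1) * \<rho> powr (a - real d)) * (k * \<rho> powr \<nu>) ^ r * exp (- (c * \<rho> powr \<nu>))"
      unfolding 2 by (simp add: power_mult_distrib exp_minus divide_inverse)
    finally show ?thesis
      using True by (simp add: c_def mult_ac)
  qed (simp add: w_def)
  ultimately have "has_bochner_integral lborel (\<lambda>\<rho>. (indicator {0<..} \<rho> * \<rho> ^ (d - 1)) *\<^sub>R
      (\<rho> powr (a - real d) * (k * \<rho> powr \<nu>) ^ r * exp (- (k * \<rho> powr \<nu>) * \<phi>)))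
      (1 / \<nu> * Gamma (a / \<nu> + r) * k powr (- (a / \<nu>)) * \<phi> powr (- (a / \<nu> + r)))"
    by simp
  then show ?thesis
    unfolding radial_measure_def by (intro has_bochner_integral_density) (auto simp: indicator_def)
qed

text \<open>
  Because the rate \<open>\<phi>\<close> depends on the direction, the radial integral is carried out first, for
  each direction; the lower bound on \<open>\<phi>\<close> makes the resulting function of the direction integrable.
\<close>

lemma has_bochner_integral_radial_angular:
  fixes H \<phi> :: "'a::euclidean_space \<Rightarrow> real"
  assumes H: "integrable sphere_measure H"
    and \<phi>m: "\<phi> \<in> borel_measurable (restrict_space borel (sphere 0 1))"
    and \<phi>: "\<And>\<omega>. norm \<omega> = 1 \<Longrightarrow> c \<le> \<phi> \<omega>" and c: "0 < c"
    and a: "0 < a" and \<nu>: "0 < \<nu>" and k: "0 < k"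
  shows "has_bochner_integral lebesgue
      (\<lambda>x. norm x powr (a - real DIM('a)) * (k * norm x powr \<nu>) ^ r
             * exp (- (k * norm x powr \<nu>) * \<phi> (unit_vector x)) * H (unit_vector x))
      (1 / \<nu> * Gamma (a / \<nu> + r) * k powr (- (a / \<nu>))
         * (\<integral>\<omega>. \<phi> \<omega> powr (- (a / \<nu> + r)) * H \<omega> \<partial>sphere_measure))" (is ?thesis1)
    and "integrable sphere_measure (\<lambda>\<omega>. \<phi> \<omega> powr (- (a / \<nu> + r)) * H \<omega>)" (is ?thesis2)
proof -
  let ?S = "restrict_space borel (sphere (0::'a) 1)"
  let ?\<mu> = "sphere_borel_measure :: 'a measure" and ?\<tau> = "radial_measure DIM('a)"
  interpret pair_sigma_finite ?\<mu> ?\<tau> by (rule pair_sigma_finite_polar)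
  define s where "s = a / \<nu> + r"
  define C where "C = 1 / \<nu> * Gamma (a / \<nu> + r) * k powr (- (a / \<nu>))"
  have s: "0 \<le> s" unfolding s_def using a \<nu> by (intro add_nonneg_nonneg divide_nonneg_nonneg) auto
  obtain H' where H': "integrable ?\<mu> H'" and ae: "AE \<omega> in ?\<mu>. H \<omega> = H' \<omega>"
    using integrable_completionD_AE[OF H[unfolded sphere_measure_eq_completion]] by blast
  have [measurable]: "H' \<in> borel_measurable ?S"
    using borel_measurable_integrable[OF H'] by simp
  have [measurable]: "\<phi> \<in> borel_measurable ?\<mu>" "\<phi> \<in> borel_measurable ?S" using \<phi>m by simp_all
  have int0: "integrable ?\<mu> (\<lambda>\<omega>. \<phi> \<omega> powr (- s) * H' \<omega>)"
  proof (rule Bochner_Integration.integrable_bound)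
    show "integrable ?\<mu> (\<lambda>\<omega>. c powr (- s) * H' \<omega>)" using H' by simp
    show "(\<lambda>\<omega>. \<phi> \<omega> powr (- s) * H' \<omega>) \<in> borel_measurable ?\<mu>" by measurable
    have "\<phi> \<omega> powr (- s) \<le> c powr (- s)" if "norm \<omega> = 1" for \<omega>
      using \<phi>[OF that] c s by (intro powr_mono2') auto
    then show "AE \<omega> in ?\<mu>. norm (\<phi> \<omega> powr (- s) * H' \<omega>) \<le> norm (c powr (- s) * H' \<omega>)"
      by (intro AE_I2) (auto simp: abs_mult intro!: mult_right_mono)
  qed
  have aes: "AE \<omega> in ?\<mu>. \<phi> \<omega> powr (- s) * H \<omega> = \<phi> \<omega> powr (- s) * H' \<omega>"
    using ae by eventually_elim simp
  have angular: "has_bochner_integral sphere_measure (\<lambda>\<omega>. \<phi> \<omega> powr (- s) * H \<omega>)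
      (\<integral>\<omega>. \<phi> \<omega> powr (- s) * H' \<omega> \<partial>?\<mu>)"
    unfolding sphere_measure_eq_completion
    by (rule has_bochner_integral_completionI_AE[OF has_bochner_integral_integrable[OF int0] aes])
  then show ?thesis2 by (simp add: has_bochner_integral_iff s_def)
  define w where "w \<omega> \<rho> = \<rho> powr (a - real DIM('a)) * (k * \<rho> powr \<nu>) ^ r * exp (- (k * \<rho> powr \<nu>) * \<phi> \<omega>)"
    for \<omega> \<rho>
  have w0: "0 \<le> w \<omega> \<rho>" for \<omega> \<rho> using k by (simp add: w_def)
  have radial: "has_bochner_integral ?\<tau> (\<lambda>\<rho>. w \<omega> \<rho> * y) (C * \<phi> \<omega> powr (- s) * y)" if "norm \<omega> = 1" for \<omega> y
    unfolding w_def C_def s_def using \<phi>[OF that] c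
    by (intro has_bochner_integral_mult_left has_bochner_integral_radial a \<nu> k) auto
  define \<Phi> where "\<Phi> z = w (fst z) (snd z) * H' (fst z)" for z
  have \<Phi>m: "\<Phi> \<in> borel_measurable (?\<mu> \<Otimes>\<^sub>M ?\<tau>)" unfolding \<Phi>_def w_def by measurable
  have \<Phi>m': "\<Phi> \<in> borel_measurable (?S \<Otimes>\<^sub>M borel)" unfolding \<Phi>_def w_def by measurable
  have "integrable (?\<mu> \<Otimes>\<^sub>M ?\<tau>) \<Phi>"
  proof (rule Fubini_integrable[OF \<Phi>m])
    have "(\<integral>\<rho>. norm (\<Phi> (\<omega>, \<rho>)) \<partial>?\<tau>) = C * norm (\<phi> \<omega> powr (- s) * H' \<omega>)" if "\<omega> \<in> space ?\<mu>" for \<omega>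
      using has_bochner_integral_integral_eq[OF radial[of \<omega> "\<bar>H' \<omega>\<bar>"]] that w0
      by (simp add: \<Phi>_def abs_mult mult.assoc)
    moreover have "integrable ?\<mu> (\<lambda>\<omega>. C * norm (\<phi> \<omega> powr (- s) * H' \<omega>))"
      using int0 by (intro integrable_mult_right integrable_norm) auto
    ultimately show "integrable ?\<mu> (\<lambda>\<omega>. \<integral>\<rho>. norm (\<Phi> (\<omega>, \<rho>)) \<partial>?\<tau>)"
      by (subst Bochner_Integration.integrable_cong[OF refl]) assumption+
    have "integrable ?\<tau> (\<lambda>\<rho>. \<Phi> (\<omega>, \<rho>))" if "norm \<omega> = 1" for \<omega>
      using radial[OF that, of "H' \<omega>"] by (simp add: \<Phi>_def has_bochner_integral_iff)
    then show "AE \<omega> in ?\<mu>. integrable ?\<tau> (\<lambda>\<rho>. \<Phi> (\<omega>, \<rho>))"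
      by (intro AE_I2) simp
  qed
  moreover have "integral\<^sup>L (?\<mu> \<Otimes>\<^sub>M ?\<tau>) \<Phi> = C * (\<integral>\<omega>. \<phi> \<omega> powr (- s) * H' \<omega> \<partial>?\<mu>)"
  proof -
    have "integral\<^sup>L (?\<mu> \<Otimes>\<^sub>M ?\<tau>) \<Phi> = (\<integral>\<omega>. (\<integral>\<rho>. \<Phi> (\<omega>, \<rho>) \<partial>?\<tau>) \<partial>?\<mu>)"
      using integral_fst'[OF calculation] by simp
    also have "\<dots> = (\<integral>\<omega>. C * (\<phi> \<omega> powr (- s) * H' \<omega>) \<partial>?\<mu>)"
    proof (rule Bochner_Integration.integral_cong[OF refl])
      fix \<omega> assume "\<omega> \<in> space ?\<mu>"
      then have "norm \<omega> = 1" by simp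
      from has_bochner_integral_integral_eq[OF radial[OF this, of "H' \<omega>"]]
      show "(\<integral>\<rho>. \<Phi> (\<omega>, \<rho>) \<partial>?\<tau>) = C * (\<phi> \<omega> powr (- s) * H' \<omega>)"
        by (simp add: \<Phi>_def mult.assoc)
    qed
    finally show ?thesis by simp
  qed
  ultimately have "has_bochner_integral (distr lborel (?S \<Otimes>\<^sub>M borel) polar) \<Phi>
      (C * (\<integral>\<omega>. \<phi> \<omega> powr (- s) * H' \<omega> \<partial>?\<mu>))"
    unfolding distr_polar by (simp add: has_bochner_integral_iff)
  then have "has_bochner_integral lborel (\<lambda>x. \<Phi> (polar x)) (C * (\<integral>\<omega>. \<phi> \<omega> powr (- s) * H' \<omega> \<partial>?\<mu>))"
    using \<Phi>m' by (simp add: has_bochner_integral_iff integrable_distr_eq integral_distr)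
  moreover have "AE x in lborel. w (unit_vector x) (norm x) * H (unit_vector x) = \<Phi> (polar x)"
    using AE_unit_vector[OF ae] by eventually_elim (simp add: \<Phi>_def polar_def)
  ultimately have "has_bochner_integral lebesgue (\<lambda>x. w (unit_vector x) (norm x) * H (unit_vector x))
      (C * (\<integral>\<omega>. \<phi> \<omega> powr (- s) * H' \<omega> \<partial>?\<mu>))"
    by (rule has_bochner_integral_completionI_AE)
  then show ?thesis1
    using has_bochner_integral_integral_eq[OF angular] by (simp add: w_def C_def s_def)
qed

section \<open>Integrability of the coefficients of an expansion\<close>

text \<open>
  Induction on the degree: the divided difference at some \<open>t0 \<in> T\<close> is a polynomial of lower
  degree that is again integrable for all other \<open>t \<in> T\<close>, and the coefficients of
  positive index can be recovered from its coefficients.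
\<close>

lemma integrable_polynomial_coefficients:
  fixes c :: "nat \<Rightarrow> 'a \<Rightarrow> real"
  assumes "infinite T"
    and "\<And>t. t \<in> T \<Longrightarrow> integrable M (\<lambda>x. \<Sum>i\<le>N. c i x * t ^ i)"
    and "j \<le> N"
  shows "integrable M (c j)"
  using assms
proof (induction N arbitrary: c j T)
  case 0
  then obtain t where "t \<in> T" by (metis finite.emptyI ex_in_conv)
  with 0 show ?case by auto
next
  case (Suc N)
  obtain t0 where t0: "t0 \<in> T" using Suc.prems(1) by (metis finite.emptyI ex_in_conv)
  \<comment> \<open>The coefficients of the divided difference at \<open>t0\<close>.\<close>
  define b where "b l x = (\<Sum>i=Suc l..Suc N. c i x * t0 ^ (i - l - 1))" for l x
  have b: "integrable M (b l)" if "l \<le> N" for l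
  proof (rule Suc.IH[OF _ _ that])
    show "infinite (T - {t0})" using Suc.prems(1) by simp
    fix t assume t: "t \<in> T - {t0}"
    have "(\<Sum>i\<le>Suc N. c i x * t ^ i) - (\<Sum>i\<le>Suc N. c i x * t0 ^ i) = (t - t0) * (\<Sum>l\<le>N. b l x * t ^ l)" for x
      unfolding b_def using polyfun_diff[of "Suc N" "\<lambda>i. c i x" t t0] by (simp add: lessThan_Suc_atMost del: sum.atMost_Suc)
    then have eq: "(\<Sum>l\<le>N. b l x * t ^ l)
        = ((\<Sum>i\<le>Suc N. c i x * t ^ i) - (\<Sum>i\<le>Suc N. c i x * t0 ^ i)) / (t - t0)" for x
      using t by (simp del: sum.atMost_Suc)
    show "integrable M (\<lambda>x. \<Sum>l\<le>N. b l x * t ^ l)"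
      unfolding eq using t t0 by (intro integrable_divide Bochner_Integration.integrable_diff Suc.prems(2)) auto
  qed
  have pos: "integrable M (c (Suc l))" if "l \<le> N" for l
  proof (cases "l = N")
    case True
    have "b N = c (Suc N)" by (rule ext) (simp add: b_def)
    with b[of N] True show ?thesis by simp
  next
    case False
    have "c (Suc l) x = b l x - t0 * b (Suc l) x" for x
    proof -
      have "b l x = c (Suc l) x + (\<Sum>i=Suc (Suc l)..Suc N. c i x * t0 ^ (i - l - 1))"
        unfolding b_def using that by (subst sum.atLeast_Suc_atMost) auto
      also have "(\<Sum>i=Suc (Suc l)..Suc N. c i x * t0 ^ (i - l - 1)) = t0 * b (Suc l) x"
        unfolding b_def sum_distrib_left
      proof (intro sum.cong refl)
        fix i assume "i \<in> {Suc (Suc l)..Suc N}"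
        then have "i - l - 1 = Suc (i - Suc l - 1)" by auto
        then show "c i x * t0 ^ (i - l - 1) = t0 * (c i x * t0 ^ (i - Suc l - 1))" by simp
      qed
      finally show ?thesis by simp
    qed
    then have "c (Suc l) = (\<lambda>x. b l x - t0 * b (Suc l) x)" by (rule ext)
    with b[of l] b[of "Suc l"] that False show ?thesis by simp
  qed
  show ?case
  proof (cases j)
    case (Suc l)
    with pos Suc.prems(3) show ?thesis by simp
  next
    case 0
    have "c 0 x = (\<Sum>i\<le>Suc N. c i x * t0 ^ i) - (\<Sum>l\<le>N. c (Suc l) x * t0 ^ Suc l)" for x
      by (subst sum.atMost_Suc_shift) simp
    then have "c 0 = (\<lambda>x. (\<Sum>i\<le>Suc N. c i x * t0 ^ i) - (\<Sum>l\<le>N. c (Suc l) x * t0 ^ Suc l))"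
      by (rule ext)
    moreover have "integrable M (\<lambda>x. (\<Sum>i\<le>Suc N. c i x * t0 ^ i) - (\<Sum>l\<le>N. c (Suc l) x * t0 ^ Suc l))"
      using t0 pos by (intro Bochner_Integration.integrable_diff Suc.prems(2) Bochner_Integration.integrable_sum integrable_mult_left) auto
    ultimately show ?thesis using 0 by metis
  qed
qed

lemma exists_arbitrarily_small_AE:
  fixes P :: "real \<Rightarrow> bool"
  assumes ae: "AE r in lborel. 0 < r \<longrightarrow> P r" and \<delta>: "0 < \<delta>"
  shows "\<exists>r. 0 < r \<and> r < \<delta> \<and> P r"
proof (rule ccontr)
  assume neg: "\<not> (\<exists>r. 0 < r \<and> r < \<delta> \<and> P r)"
  have "AE r in lborel. r \<notin> {0<..<\<delta>}" using ae by eventually_elim (use neg in auto)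
  then have "{0<..<\<delta>} \<in> null_sets lborel" by (subst AE_iff_null_sets) auto
  then show False using \<delta> by (auto simp: null_sets_def)
qed

text \<open>
  Only slices \<open>h (\<rho> *\<^sub>R \<omega>)\<close> for almost every \<open>\<rho>\<close> are known to be integrable.  The set \<open>T\<close> of good
  radii accumulates at \<open>0\<close>, which is enough both for the limits that give measurability and for
  \<open>integrable_polynomial_coefficients\<close>.
\<close>

lemma integrable_expansion_coefficients:
  fixes h :: "'a::euclidean_space \<Rightarrow> real"
  assumes h: "integrable lebesgue h"
    and approx: "\<And>\<epsilon>. 0 < \<epsilon> \<Longrightarrow> \<exists>\<delta>>0. \<forall>\<rho> \<omega>. 0 < \<rho> \<longrightarrow> \<rho> < \<delta> \<longrightarrow> norm \<omega> = 1 \<longrightarrow>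
        \<bar>\<rho> powr q * h (\<rho> *\<^sub>R \<omega>) - (\<Sum>j\<le>N. G j \<omega> * \<rho> ^ j)\<bar> \<le> \<epsilon> * \<rho> ^ N"
    and j: "j \<le> N"
  shows "integrable sphere_measure (G j)"
proof -
  define p where "p \<rho> \<omega> = \<rho> powr q * h (\<rho> *\<^sub>R \<omega>)" for \<rho> \<omega>
  define T where "T = {\<rho>. 0 < \<rho> \<and> integrable sphere_measure (p \<rho>)}"
  have T_small: "\<exists>r\<in>T. r < \<delta>" if "0 < \<delta>" for \<delta>
    using exists_arbitrarily_small_AE[OF AE_integrable_sphere_slices[OF h] that]
    by (auto simp: T_def p_def[abs_def])
  have meas: "G j \<in> borel_measurable sphere_measure" if "j \<le> N" for j
    using that
  proof (induction j rule: less_induct)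
    case (less j)
    have "\<forall>n. \<exists>r. r \<in> T \<and> r < inverse (real (Suc n))" 
    proof
      fix n :: nat
      have "0 < inverse (real (Suc n))" by simp
      from T_small[OF this] show "\<exists>r. r \<in> T \<and> r < inverse (real (Suc n))" by blast
    qed
    then obtain t where t: "\<And>n. t n \<in> T" "\<And>n. t n < inverse (real (Suc n))" by metis
    have t0: "0 < t n" for n using t(1)[of n] by (simp add: T_def)
    have "t \<longlonglongrightarrow> 0"
      by (rule tendsto_sandwich[OF _ _ tendsto_const LIMSEQ_inverse_real_of_nat])
         (use t t0 in \<open>auto intro!: always_eventually less_imp_le\<close>)
    show ?case
    proof (rule borel_measurable_LIMSEQ_real)
      show "(\<lambda>\<omega>. (p (t n) \<omega> - (\<Sum>i<j. G i \<omega> * t n ^ i)) / t n ^ j) \<in> borel_measurable sphere_measure" for n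
        using t(1)[of n] less
        by (intro borel_measurable_divide borel_measurable_diff borel_measurable_sum borel_measurable_times
            borel_measurable_const) (auto simp: T_def borel_measurable_integrable)
      fix \<omega> :: 'a assume "\<omega> \<in> space sphere_measure"
      then have \<omega>: "norm \<omega> = 1" by (simp add: space_sphere_measure)
      \<comment> \<open>The error is divided by \<open>t n ^ j\<close> and still tends to \<open>0\<close>, as it is \<open>o(t n ^ N)\<close>.\<close>
      define e where "e n = (p (t n) \<omega> - (\<Sum>i\<le>N. G i \<omega> * t n ^ i)) / t n ^ j" for n
      have "e \<longlonglongrightarrow> 0"
      proof (rule LIMSEQ_I)
        fix \<epsilon> :: real assume \<epsilon>: "0 < \<epsilon>"
        obtain \<delta> where \<delta>: "0 < \<delta>" and bound: "\<And>\<rho>. 0 < \<rho> \<Longrightarrow> \<rho> < \<delta> \<Longrightarrow>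
            \<bar>p \<rho> \<omega> - (\<Sum>i\<le>N. G i \<omega> * \<rho> ^ i)\<bar> \<le> \<epsilon> / 2 * \<rho> ^ N"
          using approx[of "\<epsilon> / 2"] \<epsilon> \<omega> unfolding p_def by (metis half_gt_zero)
        obtain n0 where n0: "\<And>n. n0 \<le> n \<Longrightarrow> t n < min \<delta> 1"
          using order_tendstoD(2)[OF \<open>t \<longlonglongrightarrow> 0\<close>, of "min \<delta> 1"] \<delta> by (auto simp: eventually_sequentially)
        have "norm (e n - 0) < \<epsilon>" if "n0 \<le> n" for n
        proof -
          have tn: "t n < \<delta>" "t n \<le> 1" using n0[OF that] by auto
          have "t n ^ N \<le> t n ^ j" using t0[of n] tn less.prems by (intro power_decreasing) auto
          then have "\<epsilon> / 2 * t n ^ N \<le> \<epsilon> / 2 * t n ^ j" using \<epsilon> by (intro mult_left_mono) auto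
          with bound[OF t0 tn(1)] have "\<bar>p (t n) \<omega> - (\<Sum>i\<le>N. G i \<omega> * t n ^ i)\<bar> \<le> \<epsilon> / 2 * t n ^ j"
            by linarith
          then have "\<bar>e n\<bar> \<le> \<epsilon> / 2" using t0[of n] by (simp add: e_def abs_div pos_divide_le_eq)
          with \<epsilon> show ?thesis by simp
        qed
        then show "\<exists>no. \<forall>n\<ge>no. norm (e n - 0) < \<epsilon>" by blast
      qed
      moreover have "(\<lambda>n. \<Sum>i=j..N. G i \<omega> * t n ^ (i - j)) \<longlonglongrightarrow> (\<Sum>i=j..N. G i \<omega> * 0 ^ (i - j))"
        by (intro tendsto_intros \<open>t \<longlonglongrightarrow> 0\<close>)
      moreover have "(\<Sum>i=j..N. G i \<omega> * 0 ^ (i - j)) = G j \<omega>"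
        using less.prems by (subst sum.atLeast_Suc_atMost) (auto intro!: sum.neutral simp: zero_power)
      ultimately have lim: "(\<lambda>n. e n + (\<Sum>i=j..N. G i \<omega> * t n ^ (i - j))) \<longlonglongrightarrow> G j \<omega>"
        using tendsto_add by fastforce
      have "e n + (\<Sum>i=j..N. G i \<omega> * t n ^ (i - j)) = (p (t n) \<omega> - (\<Sum>i<j. G i \<omega> * t n ^ i)) / t n ^ j" for n
      proof -
        have "{..N} = {..<j} \<union> {j..N}" "{..<j} \<inter> {j..N} = {}" using less.prems by auto
        then have "(\<Sum>i\<le>N. G i \<omega> * t n ^ i) = (\<Sum>i<j. G i \<omega> * t n ^ i) + (\<Sum>i=j..N. G i \<omega> * t n ^ i)"
          by (simp add: sum.union_disjoint)
        moreover have "(\<Sum>i=j..N. G i \<omega> * t n ^ i) = t n ^ j * (\<Sum>i=j..N. G i \<omega> * t n ^ (i - j))"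
          unfolding sum_distrib_left by (intro sum.cong refl) (simp add: power_add[symmetric] mult.left_commute)
        ultimately show ?thesis using t0[of n] by (simp add: e_def field_simps)
      qed
      then show "(\<lambda>n. (p (t n) \<omega> - (\<Sum>i<j. G i \<omega> * t n ^ i)) / t n ^ j) \<longlonglongrightarrow> G j \<omega>"
        using lim by simp
    qed
  qed
  obtain \<delta> where \<delta>: "0 < \<delta>" and bound: "\<And>\<rho> \<omega>. 0 < \<rho> \<Longrightarrow> \<rho> < \<delta> \<Longrightarrow> norm \<omega> = 1 \<Longrightarrow>
      \<bar>p \<rho> \<omega> - (\<Sum>j\<le>N. G j \<omega> * \<rho> ^ j)\<bar> \<le> 1 * \<rho> ^ N"
    using approx[of 1] unfolding p_def by auto
  have "infinite {\<rho> \<in> T. \<rho> < \<delta>}"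
  proof
    assume fin: "finite {\<rho> \<in> T. \<rho> < \<delta>}"
    have ne: "{\<rho> \<in> T. \<rho> < \<delta>} \<noteq> {}" using T_small[OF \<delta>] by auto
    define m where "m = Min {\<rho> \<in> T. \<rho> < \<delta>}"
    have m: "m \<in> {\<rho> \<in> T. \<rho> < \<delta>}" unfolding m_def by (rule Min_in[OF fin ne])
    then have "0 < m" by (simp add: T_def)
    then obtain r where r: "r \<in> T" "r < m" using T_small by blast
    then have "r < \<delta>" using m by simp
    then have "m \<le> r" unfolding m_def using r(1) by (intro Min_le[OF fin]) simp
    with r show False by simp
  qed
  then show ?thesis
  proof (rule integrable_polynomial_coefficients[OF _ _ j])
    fix \<rho> assume \<rho>: "\<rho> \<in> {\<rho> \<in> T. \<rho> < \<delta>}"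
    interpret finite_measure "sphere_borel_measure :: 'a measure"
      by (rule finite_measure_sphere_borel_measure)
    have const: "integrable (sphere_measure :: 'a measure) (\<lambda>\<omega>. \<rho> ^ N)"
      unfolding sphere_measure_eq_completion by (subst integrable_completion) auto
    show "integrable sphere_measure (\<lambda>\<omega>. \<Sum>i\<le>N. G i \<omega> * \<rho> ^ i)"
    proof (rule Bochner_Integration.integrable_bound)
      show "integrable sphere_measure (\<lambda>\<omega>. \<bar>p \<rho> \<omega>\<bar> + \<rho> ^ N)"
        using \<rho> const by (auto simp: T_def)
      show "(\<lambda>\<omega>. \<Sum>i\<le>N. G i \<omega> * \<rho> ^ i) \<in> borel_measurable sphere_measure"
        using meas by (intro borel_measurable_sum borel_measurable_times) auto
      have "\<bar>\<Sum>i\<le>N. G i \<omega> * \<rho> ^ i\<bar> \<le> \<bar>p \<rho> \<omega>\<bar> + \<rho> ^ N" if "norm \<omega> = 1" for \<omega>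
        using bound[of \<rho> \<omega>] \<rho> that by (simp add: T_def)
      then show "AE \<omega> in sphere_measure. norm (\<Sum>i\<le>N. G i \<omega> * \<rho> ^ i) \<le> norm (\<bar>p \<rho> \<omega>\<bar> + \<rho> ^ N)"
        using \<rho> by (intro AE_I2) (auto simp: space_sphere_measure T_def intro: order_trans[OF _ abs_ge_self])
    qed
  qed
qed

text \<open>
  Where \<open>f\<close> is bounded above, integrability of \<open>exp (- k0 * f x) * g x\<close> gives that of \<open>g\<close>.
\<close>

lemma integrable_coefficients_of_factor:
  fixes f g :: "'a::euclidean_space \<Rightarrow> real"
  assumes int: "integrable lebesgue (\<lambda>x. indicator R x * (exp (- k0 * f x) * g x))"
    and k0: "0 < k0"
    and sub: "ball 0 \<delta> \<subseteq> R" and \<delta>: "0 < \<delta>" and f_bound: "\<And>x. norm x < \<delta> \<Longrightarrow> f x \<le> b"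
    and g_meas: "(\<lambda>x. indicator R x * g x) \<in> borel_measurable lebesgue"
    and g_exp: "\<And>c. 0 < c \<Longrightarrow> \<exists>\<delta>>0. \<forall>\<rho> \<omega>. 0 < \<rho> \<longrightarrow> \<rho> < \<delta> \<longrightarrow> norm \<omega> = 1 \<longrightarrow>
        \<bar>g (\<rho> *\<^sub>R \<omega>) - \<rho> powr (lam - real DIM('a)) * (\<Sum>j\<le>N. G j \<omega> * \<rho> ^ j)\<bar>
          \<le> c * (\<rho> powr (lam - real DIM('a)) * \<rho> ^ N)"
    and j: "j \<le> N"
  shows "integrable sphere_measure (G j)"
proof (rule integrable_expansion_coefficients[OF _ _ j])
  define h where "h x = indicator (ball 0 \<delta>) x * g x" for x
  have h_eq: "h x = indicator (ball 0 \<delta>) x * (indicator R x * g x)" for x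
    using sub by (auto simp: h_def indicator_def)
  show "integrable lebesgue h"
  proof (rule Bochner_Integration.integrable_bound)
    show "integrable lebesgue (\<lambda>x. exp (k0 * b) * (indicator R x * (exp (- k0 * f x) * g x)))"
      using int by simp
    show "h \<in> borel_measurable lebesgue"
      unfolding h_eq[abs_def] by (rule borel_measurable_times[OF borel_measurable_indicator g_meas]) simp
    have "norm (h x) \<le> norm (exp (k0 * b) * (indicator R x * (exp (- k0 * f x) * g x)))" for x
    proof (cases "norm x < \<delta>")
      case True
      then have "x \<in> R" using sub by auto
      have "1 \<le> exp (k0 * b) * exp (- k0 * f x)"
        using f_bound[OF True] k0 by (simp add: exp_add[symmetric])
      then have "1 * \<bar>g x\<bar> \<le> exp (k0 * b) * exp (- k0 * f x) * \<bar>g x\<bar>" by (intro mult_right_mono) auto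
      with True \<open>x \<in> R\<close> show ?thesis by (simp add: h_def abs_mult)
    qed (simp add: h_def)
    then show "AE x in lebesgue. norm (h x) \<le> norm (exp (k0 * b) * (indicator R x * (exp (- k0 * f x) * g x)))"
      by simp
  qed
  fix \<epsilon> :: real assume \<epsilon>: "0 < \<epsilon>"
  obtain \<delta>' where \<delta>': "0 < \<delta>'" and approx: "\<And>\<rho> \<omega>. 0 < \<rho> \<Longrightarrow> \<rho> < \<delta>' \<Longrightarrow> norm \<omega> = 1 \<Longrightarrow>
        \<bar>g (\<rho> *\<^sub>R \<omega>) - \<rho> powr (lam - real DIM('a)) * (\<Sum>j\<le>N. G j \<omega> * \<rho> ^ j)\<bar>
          \<le> \<epsilon> * (\<rho> powr (lam - real DIM('a)) * \<rho> ^ N)"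
    using g_exp[OF \<epsilon>] by blast
  have "\<bar>\<rho> powr (real DIM('a) - lam) * h (\<rho> *\<^sub>R \<omega>) - (\<Sum>j\<le>N. G j \<omega> * \<rho> ^ j)\<bar> \<le> \<epsilon> * \<rho> ^ N"
    if \<rho>: "0 < \<rho>" "\<rho> < min \<delta> \<delta>'" and \<omega>: "norm \<omega> = 1" for \<rho> \<omega>
  proof -
    define q where "q = \<rho> powr (lam - real DIM('a))"
    have q: "0 < q" using \<rho> by (simp add: q_def)
    have inv: "\<rho> powr (real DIM('a) - lam) = 1 / q"
      using \<rho> powr_minus_divide[of \<rho> "lam - real DIM('a)"] by (simp add: q_def)
    have hg: "h (\<rho> *\<^sub>R \<omega>) = g (\<rho> *\<^sub>R \<omega>)" using \<rho> \<omega> by (simp add: h_def)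
    have "\<bar>g (\<rho> *\<^sub>R \<omega>) - q * (\<Sum>j\<le>N. G j \<omega> * \<rho> ^ j)\<bar> \<le> \<epsilon> * (q * \<rho> ^ N)"
      unfolding q_def using \<rho> \<omega> by (intro approx) auto
    moreover have "g (\<rho> *\<^sub>R \<omega>) - q * (\<Sum>j\<le>N. G j \<omega> * \<rho> ^ j)
        = q * (1 / q * g (\<rho> *\<^sub>R \<omega>) - (\<Sum>j\<le>N. G j \<omega> * \<rho> ^ j))"
      using q by (simp add: right_diff_distrib)
    ultimately have "q * \<bar>1 / q * g (\<rho> *\<^sub>R \<omega>) - (\<Sum>j\<le>N. G j \<omega> * \<rho> ^ j)\<bar> \<le> q * (\<epsilon> * \<rho> ^ N)"
      using q by (simp only: abs_mult abs_of_pos) (simp only: mult.left_commute)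
    then show ?thesis unfolding inv hg using q by simp
  qed
  then show "\<exists>\<delta>>0. \<forall>\<rho> \<omega>. 0 < \<rho> \<longrightarrow> \<rho> < \<delta> \<longrightarrow> norm \<omega> = 1 \<longrightarrow>
        \<bar>\<rho> powr (real DIM('a) - lam) * h (\<rho> *\<^sub>R \<omega>) - (\<Sum>j\<le>N. G j \<omega> * \<rho> ^ j)\<bar> \<le> \<epsilon> * \<rho> ^ N"
    using \<delta> \<delta>' by (intro exI[of _ "min \<delta> \<delta>'"]) auto
qed

section \<open>The integral of the model\<close>

lemma continuous_on_composition_sum:
  assumes "\<And>j. j \<le> N \<Longrightarrow> continuous_on S (F j)" and "m \<le> N"
  shows "continuous_on S (\<lambda>\<omega>. composition_sum (\<lambda>i. F i \<omega>) r m)"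
  using \<open>m \<le> N\<close>
proof (induction r arbitrary: m)
  case 0
  then show ?case by (simp add: composition_sum_0)
next
  case (Suc r)
  then show ?case
    unfolding composition_sum_Suc by (intro continuous_intros assms(1) Suc.IH) auto
qed

lemma integrable_sphere_continuous_mult:
  fixes q H :: "'a::euclidean_space \<Rightarrow> real"
  assumes q: "continuous_on (sphere 0 1) q" and H: "integrable sphere_measure H"
  shows "integrable sphere_measure (\<lambda>\<omega>. q \<omega> * H \<omega>)"
proof -
  have "bounded (q ` sphere 0 1)"
    by (rule compact_imp_bounded[OF compact_continuous_image[OF q compact_sphere]])
  then obtain B where "\<forall>y\<in>q ` sphere 0 1. norm y \<le> B" unfolding bounded_iff by blast
  then have B: "\<bar>q \<omega>\<bar> \<le> B" if "norm \<omega> = 1" for \<omega> using that by simp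
  show ?thesis
  proof (rule Bochner_Integration.integrable_bound)
    show "integrable sphere_measure (\<lambda>\<omega>. B * H \<omega>)" using H by simp
    have "q \<in> borel_measurable (restrict_space borel (sphere 0 1))"
      by (rule borel_measurable_continuous_on_restrict[OF q])
    then have "q \<in> borel_measurable (sphere_borel_measure :: 'a measure)" by simp
    then have "q \<in> borel_measurable sphere_measure"
      unfolding sphere_measure_eq_completion by (rule measurable_completion)
    then show "(\<lambda>\<omega>. q \<omega> * H \<omega>) \<in> borel_measurable sphere_measure"
      by (rule borel_measurable_times[OF _ borel_measurable_integrable[OF H]])
    have "norm (q \<omega> * H \<omega>) \<le> norm (B * H \<omega>)" if "norm \<omega> = 1" for \<omega>
      using B[OF that] by (auto simp: abs_mult intro!: mult_right_mono)
    then show "AE \<omega> in sphere_measure. norm (q \<omega> * H \<omega>) \<le> norm (B * H \<omega>)"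
      by (intro AE_I2) (simp add: space_sphere_measure)
  qed
qed

lemma Gamma_plus_of_nat_eq_gbinomial:
  fixes \<alpha> :: real
  assumes "0 < \<alpha>"
  shows "(- 1) ^ r / fact r * Gamma (\<alpha> + real r) = Gamma \<alpha> * (- \<alpha> gchoose r)"
proof -
  have "\<alpha> \<notin> \<int>\<^sub>\<le>\<^sub>0" using assms by (auto elim!: nonpos_Ints_cases)
  then have "pochhammer \<alpha> r = Gamma (\<alpha> + real r) / Gamma \<alpha>" by (rule pochhammer_Gamma)
  moreover have "Gamma \<alpha> \<noteq> 0" using Gamma_real_pos[OF assms] by simp
  ultimately show ?thesis by (simp add: gbinomial_pochhammer)
qed

text \<open>
  The summand \<open>r = 0\<close> equals \<open>1\<close> for \<open>m = 0\<close> and \<open>0\<close> for \<open>m > 0\<close>, hence including it accounts for the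
  conditional in \<open>zeta_integrand\<close>.
\<close>

lemma zeta_integrand_eq:
  assumes "0 < F 0 \<omega>"
  shows "zeta_integrand \<nu> lam F G j \<omega> =
    (\<Sum>m\<le>j. \<Sum>r\<le>m. (- ((real j + lam) / \<nu>) gchoose r) *
       (F 0 \<omega> powr (- ((real j + lam) / \<nu> + real r)) * (composition_sum (\<lambda>i. F i \<omega>) r m * G (j - m) \<omega>)))"
proof -
  define \<alpha> where "\<alpha> = (real j + lam) / \<nu>"
  have inner: "(if m = 0 then 1 else \<Sum>r=1..m. (- \<alpha> gchoose r) * (composition_sum (\<lambda>i. F i \<omega>) r m / F 0 \<omega> ^ r))
      = (\<Sum>r\<le>m. (- \<alpha> gchoose r) * (composition_sum (\<lambda>i. F i \<omega>) r m / F 0 \<omega> ^ r))" for m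
  proof (cases "m = 0")
    case False
    have "{..m} = insert 0 {1..m}" by auto
    with False show ?thesis by (simp add: composition_sum_0)
  qed (simp add: composition_sum_0)
  have pw: "F 0 \<omega> powr (- (\<alpha> + real r)) = F 0 \<omega> powr (- \<alpha>) / F 0 \<omega> ^ r" for r
  proof -
    have "- (\<alpha> + real r) = - \<alpha> - real r" by simp
    then show ?thesis using assms by (simp only: powr_diff powr_realpow)
  qed
  show ?thesis
    unfolding zeta_integrand_def \<alpha>_def[symmetric] inner pw atLeast0AtMost sum_distrib_left
    by (intro sum.cong refl) (simp add: sum_distrib_left mult_ac)
qed

lemma laplace_model_term_expansion:
  fixes \<rho> u q :: real
  shows "\<rho> powr q * laplace_model N a b \<rho> u =
    (\<Sum>j\<le>N. \<Sum>m\<le>j. \<Sum>r\<le>m. (- 1) ^ r / fact r *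
       (\<rho> powr q * \<rho> ^ j * u ^ r * exp (- u * a 0) * (composition_sum a r m * b (j - m))))"
proof -
  have "(- u) ^ r = (- 1) ^ r * u ^ r" for r using power_minus[of u r] by simp
  then show ?thesis
    unfolding laplace_model_def exp_coeff_def sum_distrib_left sum_distrib_right
    by (intro sum.cong refl) (simp add: mult_ac)
qed

lemma has_bochner_integral_laplace_model:
  fixes F G :: "nat \<Rightarrow> 'a::euclidean_space \<Rightarrow> real"
  assumes F_cont: "\<And>j. j \<le> N \<Longrightarrow> continuous_on (sphere 0 1) (F j)"
    and F_pos: "\<And>\<omega>. norm \<omega> = 1 \<Longrightarrow> c \<le> F 0 \<omega>" and c: "0 < c"
    and G: "\<And>j. j \<le> N \<Longrightarrow> integrable sphere_measure (G j)"
    and lam: "0 < lam" and \<nu>: "0 < \<nu>" and k: "0 < k"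
  shows "has_bochner_integral lebesgue
      (\<lambda>x. norm x powr (lam - real DIM('a)) *
         laplace_model N (\<lambda>j. F j (unit_vector x)) (\<lambda>j. G j (unit_vector x)) (norm x) (k * norm x powr \<nu>))
      (\<Sum>j\<le>N. zeta_coeff \<nu> lam F G j * k powr (- ((real j + lam) / \<nu>)))" (is ?thesis1)
    and "\<And>j. j \<le> N \<Longrightarrow> integrable sphere_measure (zeta_integrand \<nu> lam F G j)" (is "\<And>j. _ \<Longrightarrow> ?thesis2 j")
proof -
  define \<alpha> where "\<alpha> j = (real j + lam) / \<nu>" for j
  have \<alpha>: "0 < \<alpha> j" for j using lam \<nu> by (auto simp: \<alpha>_def intro!: divide_pos_pos)
  define H where "H j m r \<omega> = composition_sum (\<lambda>i. F i \<omega>) r m * G (j - m) \<omega>" for j m r \<omega>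
  have H: "integrable sphere_measure (H j m r)" if "m \<le> j" "j \<le> N" for j m r
    unfolding H_def using that
    by (intro integrable_sphere_continuous_mult continuous_on_composition_sum[of N] F_cont G) auto
  have F0m: "F 0 \<in> borel_measurable (restrict_space borel (sphere 0 1))"
    by (rule borel_measurable_continuous_on_restrict[OF F_cont]) simp
  define I where "I j m r = (\<integral>\<omega>. F 0 \<omega> powr (- (\<alpha> j + real r)) * H j m r \<omega> \<partial>sphere_measure)" for j m r
  have summand: "has_bochner_integral lebesgue
      (\<lambda>x. norm x powr (real j + lam - real DIM('a)) * (k * norm x powr \<nu>) ^ r
             * exp (- (k * norm x powr \<nu>) * F 0 (unit_vector x)) * H j m r (unit_vector x))
      (1 / \<nu> * Gamma (\<alpha> j + r) * k powr (- \<alpha> j) * I j m r)"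
    and angular: "integrable sphere_measure (\<lambda>\<omega>. F 0 \<omega> powr (- (\<alpha> j + real r)) * H j m r \<omega>)"
    if "m \<le> j" "j \<le> N" for j m r
  proof -
    have "0 < real j + lam" using lam by simp
    note * = has_bochner_integral_radial_angular[OF H[OF that, of r] F0m F_pos c this \<nu> k, of r]
    from * show "has_bochner_integral lebesgue
      (\<lambda>x. norm x powr (real j + lam - real DIM('a)) * (k * norm x powr \<nu>) ^ r
             * exp (- (k * norm x powr \<nu>) * F 0 (unit_vector x)) * H j m r (unit_vector x))
      (1 / \<nu> * Gamma (\<alpha> j + r) * k powr (- \<alpha> j) * I j m r)"
      "integrable sphere_measure (\<lambda>\<omega>. F 0 \<omega> powr (- (\<alpha> j + real r)) * H j m r \<omega>)"
      unfolding \<alpha>_def I_def by blast+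
  qed
  have zeta: "has_bochner_integral sphere_measure (zeta_integrand \<nu> lam F G j)
      (\<Sum>m\<le>j. \<Sum>r\<le>m. (- \<alpha> j gchoose r) * I j m r)" if j: "j \<le> N" for j
  proof -
    have "has_bochner_integral sphere_measure
      (\<lambda>\<omega>. \<Sum>m\<le>j. \<Sum>r\<le>m. (- \<alpha> j gchoose r) * (F 0 \<omega> powr (- (\<alpha> j + real r)) * H j m r \<omega>))
      (\<Sum>m\<le>j. \<Sum>r\<le>m. (- \<alpha> j gchoose r) * I j m r)"
      unfolding I_def using j
      by (intro has_bochner_integral_sum has_bochner_integral_mult_right has_bochner_integral_integrable angular) auto
    moreover have "zeta_integrand \<nu> lam F G j \<omega>
        = (\<Sum>m\<le>j. \<Sum>r\<le>m. (- \<alpha> j gchoose r) * (F 0 \<omega> powr (- (\<alpha> j + real r)) * H j m r \<omega>))"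
      if "\<omega> \<in> space sphere_measure" for \<omega>
      using that c F_pos[of \<omega>] unfolding \<alpha>_def H_def
      by (intro zeta_integrand_eq) (simp add: space_sphere_measure)
    ultimately show ?thesis
      by (subst has_bochner_integral_cong[OF refl _ refl])
  qed
  then show "?thesis2 j" if "j \<le> N" for j using that by (auto simp: has_bochner_integral_iff)
  have coeff: "zeta_coeff \<nu> lam F G j * k powr (- \<alpha> j)
      = (\<Sum>m\<le>j. \<Sum>r\<le>m. (- 1) ^ r / fact r * (1 / \<nu> * Gamma (\<alpha> j + r) * k powr (- \<alpha> j) * I j m r))"
    if j: "j \<le> N" for j
  proof -
    have "(- 1) ^ r / fact r * (1 / \<nu> * Gamma (\<alpha> j + r) * k powr (- \<alpha> j) * I j m r)
        = 1 / \<nu> * Gamma (\<alpha> j) * ((- \<alpha> j gchoose r) * I j m r) * k powr (- \<alpha> j)" for m r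
    proof -
      have "(- 1) ^ r / fact r * (1 / \<nu> * Gamma (\<alpha> j + r) * k powr (- \<alpha> j) * I j m r)
          = ((- 1) ^ r / fact r * Gamma (\<alpha> j + real r)) * (1 / \<nu> * k powr (- \<alpha> j) * I j m r)" by simp
      also have "\<dots> = 1 / \<nu> * Gamma (\<alpha> j) * ((- \<alpha> j gchoose r) * I j m r) * k powr (- \<alpha> j)"
        unfolding Gamma_plus_of_nat_eq_gbinomial[OF \<alpha>] by simp
      finally show ?thesis .
    qed
    then show ?thesis
      unfolding zeta_coeff_def has_bochner_integral_integral_eq[OF zeta[OF j]]
      by (simp only: sum_distrib_left sum_distrib_right \<alpha>_def)
  qed
  have pw: "norm x powr (real j + lam - real DIM('a)) = norm x powr (lam - real DIM('a)) * norm x ^ j"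
    for x :: 'a and j
  proof (cases "x = 0")
    case False
    have "real j + lam - real DIM('a) = (lam - real DIM('a)) + real j" by simp
    with False show ?thesis by (simp only: powr_add powr_realpow zero_less_norm_iff not_False_eq_True)
  qed simp
  have expand: "norm x powr (lam - real DIM('a)) *
         laplace_model N (\<lambda>j. F j (unit_vector x)) (\<lambda>j. G j (unit_vector x)) (norm x) (k * norm x powr \<nu>)
      = (\<Sum>j\<le>N. \<Sum>m\<le>j. \<Sum>r\<le>m. (- 1) ^ r / fact r *
         (norm x powr (real j + lam - real DIM('a)) * (k * norm x powr \<nu>) ^ r
             * exp (- (k * norm x powr \<nu>) * F 0 (unit_vector x)) * H j m r (unit_vector x)))" for x
    unfolding laplace_model_term_expansion pw H_def ..
  have total: "(\<Sum>j\<le>N. zeta_coeff \<nu> lam F G j * k powr (- ((real j + lam) / \<nu>)))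
      = (\<Sum>j\<le>N. \<Sum>m\<le>j. \<Sum>r\<le>m. (- 1) ^ r / fact r * (1 / \<nu> * Gamma (\<alpha> j + r) * k powr (- \<alpha> j) * I j m r))"
    unfolding \<alpha>_def[symmetric] by (rule sum.cong[OF refl]) (rule coeff, simp)
  show ?thesis1
    unfolding expand total
    by (intro has_bochner_integral_sum has_bochner_integral_mult_right summand) auto
qed

section \<open>Comparison of the integrand with the model\<close>

text \<open>
  The majorant of the errors: its integral is a multiple of \<open>k powr (- (a / \<nu>))\<close>, so
  \<open>a = N + \<lambda>\<close> is the critical order and \<open>a = N + 1 + \<lambda>\<close> is negligible.
\<close>

definition error_weight :: "real \<Rightarrow> real \<Rightarrow> ('a::euclidean_space \<Rightarrow> real) \<Rightarrow> real \<Rightarrow> real \<Rightarrow> 'a \<Rightarrow> real" where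
  "error_weight \<kappa> \<nu> H a k x =
     norm x powr (a - real DIM('a)) * exp (- (k * norm x powr \<nu>) * \<kappa>) * H (unit_vector x)"

lemma has_bochner_integral_error_weight:
  fixes H :: "'a::euclidean_space \<Rightarrow> real"
  assumes "integrable sphere_measure H" "0 < \<kappa>" "0 < a" "0 < \<nu>" "0 < k"
  shows "has_bochner_integral lebesgue (error_weight \<kappa> \<nu> H a k)
    ((1 / \<nu> * Gamma (a / \<nu>) * (\<integral>\<omega>. \<kappa> powr (- (a / \<nu>)) * H \<omega> \<partial>sphere_measure)) * k powr (- (a / \<nu>)))"
  using has_bochner_integral_radial_angular(1)[where r = 0 and c = \<kappa> and \<phi> = "\<lambda>_. \<kappa>", OF assms(1) _ _ assms(2-5)]
  unfolding error_weight_def[abs_def] by (simp add: mult_ac)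

definition model_integrand ::
    "nat \<Rightarrow> real \<Rightarrow> real \<Rightarrow> (nat \<Rightarrow> 'a::euclidean_space \<Rightarrow> real) \<Rightarrow> (nat \<Rightarrow> 'a \<Rightarrow> real) \<Rightarrow> real \<Rightarrow> 'a \<Rightarrow> real" where
  "model_integrand N \<nu> lam F G k x = norm x powr (lam - real DIM('a)) *
     laplace_model N (\<lambda>j. F j (unit_vector x)) (\<lambda>j. G j (unit_vector x)) (norm x) (k * norm x powr \<nu>)"

text \<open>
  Divided by \<open>\<rho> powr \<nu>\<close> and \<open>\<rho> powr (lam - d)\<close> respectively, where \<open>d\<close> is the dimension, the
  expansions of \<open>f\<close> and \<open>g\<close> hold with error \<open>\<eta> * \<rho> ^ N\<close> for small \<open>\<rho>\<close>; the extra
  factor \<open>\<rho>\<close> in the truncation error is made smaller than \<open>\<eta>\<close> by shrinking \<open>\<delta>\<close>.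
\<close>

lemma integrand_minus_model_near_0:
  fixes f g :: "'a::euclidean_space \<Rightarrow> real"
  assumes c0: "0 < c0" "\<And>\<omega>. norm \<omega> = 1 \<Longrightarrow> c0 \<le> F 0 \<omega>"
    and B: "0 \<le> B" "\<And>j \<omega>. j \<le> N \<Longrightarrow> norm \<omega> = 1 \<Longrightarrow> \<bar>F j \<omega>\<bar> \<le> B"
    and f_exp: "\<And>c. 0 < c \<Longrightarrow> \<exists>\<delta>>0. \<forall>\<rho> \<omega>. 0 < \<rho> \<longrightarrow> \<rho> < \<delta> \<longrightarrow> norm \<omega> = 1 \<longrightarrow>
        \<bar>f (\<rho> *\<^sub>R \<omega>) - \<rho> powr \<nu> * (\<Sum>j\<le>N. F j \<omega> * \<rho> ^ j)\<bar> \<le> c * (\<rho> powr \<nu> * \<rho> ^ N)"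
    and g_exp: "\<And>c. 0 < c \<Longrightarrow> \<exists>\<delta>>0. \<forall>\<rho> \<omega>. 0 < \<rho> \<longrightarrow> \<rho> < \<delta> \<longrightarrow> norm \<omega> = 1 \<longrightarrow>
        \<bar>g (\<rho> *\<^sub>R \<omega>) - \<rho> powr (lam - real DIM('a)) * (\<Sum>j\<le>N. G j \<omega> * \<rho> ^ j)\<bar>
          \<le> c * (\<rho> powr (lam - real DIM('a)) * \<rho> ^ N)"
    and \<epsilon>: "0 < \<epsilon>"
  shows "\<exists>\<delta>>0. \<forall>k x. 0 < k \<longrightarrow> x \<noteq> 0 \<longrightarrow> norm x < \<delta> \<longrightarrow>
    \<bar>exp (- k * f x) * g x - model_integrand N \<nu> lam F G k x\<bar>
      \<le> \<epsilon> * error_weight (c0 / 8) \<nu> (\<lambda>\<omega>. 1 + (\<Sum>j\<le>N. \<bar>G j \<omega>\<bar>)) (real N + lam) k x"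
proof -
  obtain K \<delta>1 where K: "0 \<le> K" and \<delta>1: "0 < \<delta>1" and
    approx: "\<And>a b \<rho> u \<eta> e e'. c0 \<le> a 0 \<Longrightarrow> (\<forall>j\<le>N. \<bar>a j\<bar> \<le> B) \<Longrightarrow>
           0 < \<rho> \<Longrightarrow> \<rho> < \<delta>1 \<Longrightarrow> 0 \<le> u \<Longrightarrow> \<eta> \<le> c0 / 4 \<Longrightarrow> \<bar>e\<bar> \<le> \<eta> * \<rho> ^ N \<Longrightarrow> \<bar>e'\<bar> \<le> \<eta> * \<rho> ^ N \<Longrightarrow>
           \<bar>exp (- u * ((\<Sum>j\<le>N. a j * \<rho> ^ j) + e)) * ((\<Sum>j\<le>N. b j * \<rho> ^ j) + e') - laplace_model N a b \<rho> u\<bar>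
             \<le> K * (\<eta> + \<rho>) * \<rho> ^ N * (1 + (\<Sum>j\<le>N. \<bar>b j\<bar>)) * exp (- (c0 / 8) * u)"
    using laplace_model_approx[OF c0(1) B(1), of N] by auto
  \<comment> \<open>The bound \<open>c0 / 4\<close> keeps \<open>P + e\<close> below positive; the other one gives \<open>K * (\<eta> + \<rho>) \<le> \<epsilon>\<close> for \<open>\<rho> < \<eta>\<close>.\<close>
  define \<eta> where "\<eta> = min (c0 / 4) (\<epsilon> / (2 * (K + 1)))"
  have \<eta>: "0 < \<eta>" using c0 \<epsilon> K by (simp add: \<eta>_def)
  have \<eta>c: "\<eta> \<le> c0 / 4" unfolding \<eta>_def by (rule min.cobounded1)
  have "\<eta> \<le> \<epsilon> / (2 * (K + 1))" by (simp add: \<eta>_def)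
  then have "\<eta> * (2 * (K + 1)) \<le> \<epsilon>" using K by (subst (asm) pos_le_divide_eq) auto
  then have K\<eta>: "K * (2 * \<eta>) \<le> \<epsilon>" using \<eta> by (simp add: algebra_simps)
  obtain \<delta>2 where \<delta>2: "0 < \<delta>2" and f2: "\<And>\<rho> \<omega>. 0 < \<rho> \<Longrightarrow> \<rho> < \<delta>2 \<Longrightarrow> norm \<omega> = 1 \<Longrightarrow>
        \<bar>f (\<rho> *\<^sub>R \<omega>) - \<rho> powr \<nu> * (\<Sum>j\<le>N. F j \<omega> * \<rho> ^ j)\<bar> \<le> \<eta> * (\<rho> powr \<nu> * \<rho> ^ N)"
    using f_exp[OF \<eta>] by blast
  obtain \<delta>3 where \<delta>3: "0 < \<delta>3" and g3: "\<And>\<rho> \<omega>. 0 < \<rho> \<Longrightarrow> \<rho> < \<delta>3 \<Longrightarrow> norm \<omega> = 1 \<Longrightarrow>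
        \<bar>g (\<rho> *\<^sub>R \<omega>) - \<rho> powr (lam - real DIM('a)) * (\<Sum>j\<le>N. G j \<omega> * \<rho> ^ j)\<bar>
          \<le> \<eta> * (\<rho> powr (lam - real DIM('a)) * \<rho> ^ N)"
    using g_exp[OF \<eta>] by blast
  define \<delta> where "\<delta> = min (min \<delta>1 \<delta>2) (min \<delta>3 \<eta>)"
  have "\<bar>exp (- k * f x) * g x - model_integrand N \<nu> lam F G k x\<bar>
      \<le> \<epsilon> * error_weight (c0 / 8) \<nu> (\<lambda>\<omega>. 1 + (\<Sum>j\<le>N. \<bar>G j \<omega>\<bar>)) (real N + lam) k x"
    if k: "0 < k" and x: "x \<noteq> 0" "norm x < \<delta>" for k x
  proof -
    define \<rho> \<omega> p q where "\<rho> = norm x" and "\<omega> = unit_vector x"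
      and "p = \<rho> powr \<nu>" and "q = \<rho> powr (lam - real DIM('a))"
    define P where "P = (\<Sum>j\<le>N. F j \<omega> * \<rho> ^ j)"
    define Q where "Q = (\<Sum>j\<le>N. G j \<omega> * \<rho> ^ j)"
    define S where "S = (\<Sum>j\<le>N. \<bar>G j \<omega>\<bar>)"
    have \<rho>: "0 < \<rho>" "\<rho> < \<delta>1" "\<rho> < \<delta>2" "\<rho> < \<delta>3" "\<rho> < \<eta>" using x by (auto simp: \<rho>_def \<delta>_def)
    have \<omega>: "norm \<omega> = 1" by (simp add: \<omega>_def)
    have x_eq: "\<rho> *\<^sub>R \<omega> = x" by (simp add: \<rho>_def \<omega>_def norm_scaleR_unit_vector)
    have pq: "0 < p" "0 < q" using \<rho> by (simp_all add: p_def q_def)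
    define e where "e = f x / p - P"
    define e' where "e' = g x / q - Q"
    have fx: "f x = p * (P + e)" and gx: "g x = q * (Q + e')" using pq by (simp_all add: e_def e'_def)
    have "\<bar>p * e\<bar> \<le> \<eta> * (p * \<rho> ^ N)"
      using f2[OF \<rho>(1,3) \<omega>] unfolding x_eq P_def[symmetric] p_def[symmetric] fx by (simp add: algebra_simps)
    then have e: "\<bar>e\<bar> \<le> \<eta> * \<rho> ^ N"
      using pq by (simp add: abs_mult mult.left_commute[of \<eta> p])
    have "\<bar>q * e'\<bar> \<le> \<eta> * (q * \<rho> ^ N)"
      using g3[OF \<rho>(1,4) \<omega>] unfolding x_eq Q_def[symmetric] q_def[symmetric] gx by (simp add: algebra_simps)
    then have e': "\<bar>e'\<bar> \<le> \<eta> * \<rho> ^ N"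
      using pq by (simp add: abs_mult mult.left_commute[of \<eta> q])
    have S: "0 \<le> S" by (simp add: S_def sum_nonneg)
    let ?M = "laplace_model N (\<lambda>j. F j \<omega>) (\<lambda>j. G j \<omega>) \<rho> (k * p)"
    have "\<bar>exp (- (k * p) * (P + e)) * (Q + e') - ?M\<bar>
        \<le> K * (\<eta> + \<rho>) * \<rho> ^ N * (1 + S) * exp (- (c0 / 8) * (k * p))"
      unfolding P_def Q_def S_def
      using c0 B \<omega> \<rho> k pq \<eta>c e e' by (intro approx) auto
    also have "\<dots> \<le> \<epsilon> * \<rho> ^ N * (1 + S) * exp (- (c0 / 8) * (k * p))"
    proof -
      have "K * (\<eta> + \<rho>) \<le> K * (2 * \<eta>)" using K \<rho> by (intro mult_left_mono) auto
      also have "\<dots> \<le> \<epsilon>" by (rule K\<eta>)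
      finally show ?thesis using \<rho> S by (intro mult_right_mono) auto
    qed
    finally have main: "\<bar>exp (- (k * p) * (P + e)) * (Q + e') - ?M\<bar>
        \<le> \<epsilon> * \<rho> ^ N * (1 + S) * exp (- (c0 / 8) * (k * p))" .
    have "exp (- k * f x) * g x - model_integrand N \<nu> lam F G k x
        = q * (exp (- (k * p) * (P + e)) * (Q + e') - ?M)"
      unfolding model_integrand_def fx gx q_def[symmetric] \<rho>_def[symmetric] \<omega>_def[symmetric] p_def[symmetric]
      by (simp add: algebra_simps)
    then have "\<bar>exp (- k * f x) * g x - model_integrand N \<nu> lam F G k x\<bar>
        \<le> q * (\<epsilon> * \<rho> ^ N * (1 + S) * exp (- (c0 / 8) * (k * p)))"
      using main pq by (simp add: abs_mult)
    also have "\<dots> = \<epsilon> * error_weight (c0 / 8) \<nu> (\<lambda>\<omega>. 1 + (\<Sum>j\<le>N. \<bar>G j \<omega>\<bar>)) (real N + lam) k x"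
    proof -
      have "real N + lam - real DIM('a) = lam - real DIM('a) + real N" by simp
      then have "\<rho> powr (real N + lam - real DIM('a)) = q * \<rho> ^ N"
        using \<rho> by (simp only: powr_add powr_realpow q_def)
      then show ?thesis
        by (simp add: error_weight_def \<rho>_def[symmetric] \<omega>_def[symmetric] p_def[symmetric] S_def[symmetric] mult_ac)
    qed
    finally show ?thesis .
  qed
  moreover have "0 < \<delta>" using \<delta>1 \<delta>2 \<delta>3 \<eta> by (simp add: \<delta>_def)
  ultimately show ?thesis by blast
qed

text \<open>
  For \<open>\<rho> \<ge> \<delta>\<close> every power \<open>\<rho> ^ j\<close> with \<open>j \<le> N\<close> is at most \<open>\<rho> ^ (N + 1) / \<delta> ^ (N + 1)\<close>, which
  raises the order of the model in this region beyond the critical one.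
\<close>

lemma model_integrand_away_from_0:
  fixes F G :: "nat \<Rightarrow> 'a::euclidean_space \<Rightarrow> real"
  assumes c0: "0 < c0" "\<And>\<omega>. norm \<omega> = 1 \<Longrightarrow> c0 \<le> F 0 \<omega>"
    and B: "\<And>j \<omega>. j \<le> N \<Longrightarrow> norm \<omega> = 1 \<Longrightarrow> \<bar>F j \<omega>\<bar> \<le> B"
    and \<delta>: "0 < \<delta>" "\<delta> \<le> 1"
  shows "\<exists>C\<ge>0. \<forall>k x. 0 < k \<longrightarrow> \<delta> \<le> norm x \<longrightarrow>
    \<bar>model_integrand N \<nu> lam F G k x\<bar>
      \<le> C * error_weight (c0 / 8) \<nu> (\<lambda>\<omega>. 1 + (\<Sum>j\<le>N. \<bar>G j \<omega>\<bar>)) (real (N + 1) + lam) k x"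
proof -
  obtain K where K: "0 \<le> K" and bound: "\<And>a b \<rho> u. c0 \<le> a 0 \<Longrightarrow> (\<forall>j\<le>N. \<bar>a j\<bar> \<le> B) \<Longrightarrow> 0 \<le> \<rho> \<Longrightarrow> 0 \<le> u \<Longrightarrow>
           \<bar>laplace_model N a b \<rho> u\<bar> \<le> K * (\<Sum>j\<le>N. \<rho> ^ j) * (\<Sum>j\<le>N. \<bar>b j\<bar>) * exp (- (c0 / 8) * u)"
    using abs_laplace_model_le[OF c0(1), of N B] by auto
  define C where "C = K * (real (N + 1) / \<delta> ^ (N + 1))"
  have "\<bar>model_integrand N \<nu> lam F G k x\<bar>
      \<le> C * error_weight (c0 / 8) \<nu> (\<lambda>\<omega>. 1 + (\<Sum>j\<le>N. \<bar>G j \<omega>\<bar>)) (real (N + 1) + lam) k x"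
    if k: "0 < k" and x: "\<delta> \<le> norm x" for k x
  proof -
    define \<rho> \<omega> p q where "\<rho> = norm x" and "\<omega> = unit_vector x"
      and "p = \<rho> powr \<nu>" and "q = \<rho> powr (lam - real DIM('a))"
    define S where "S = (\<Sum>j\<le>N. \<bar>G j \<omega>\<bar>)"
    have \<rho>: "0 < \<rho>" "\<delta> \<le> \<rho>" using x \<delta> by (auto simp: \<rho>_def)
    have \<omega>: "norm \<omega> = 1" by (simp add: \<omega>_def)
    have pq: "0 < p" "0 < q" using \<rho> by (simp_all add: p_def q_def)
    have S: "0 \<le> S" by (simp add: S_def sum_nonneg)
    have "\<rho> ^ j \<le> \<rho> ^ (N + 1) / \<delta> ^ (N + 1)" if "j \<le> N" for j
    proof -
      have "\<delta> ^ (N + 1) \<le> \<delta> ^ (N + 1 - j)" using \<delta> by (intro power_decreasing) auto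
      also have "\<dots> \<le> \<rho> ^ (N + 1 - j)" using \<rho> \<delta> by (intro power_mono) auto
      finally have "\<rho> ^ j * \<delta> ^ (N + 1) \<le> \<rho> ^ j * \<rho> ^ (N + 1 - j)" using \<rho> by (intro mult_left_mono) auto
      also have "\<dots> = \<rho> ^ (N + 1)" using that by (simp add: power_add[symmetric] del: power_Suc)
      finally show ?thesis using \<delta> by (subst pos_le_divide_eq) auto
    qed
    then have "(\<Sum>j\<le>N. \<rho> ^ j) \<le> (\<Sum>j\<le>N. \<rho> ^ (N + 1) / \<delta> ^ (N + 1))" by (intro sum_mono) auto
    then have powers: "(\<Sum>j\<le>N. \<rho> ^ j) \<le> real (N + 1) / \<delta> ^ (N + 1) * \<rho> ^ (N + 1)" by simp
    let ?M = "laplace_model N (\<lambda>j. F j \<omega>) (\<lambda>j. G j \<omega>) \<rho> (k * p)"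
    have "\<bar>?M\<bar> \<le> K * (\<Sum>j\<le>N. \<rho> ^ j) * S * exp (- (c0 / 8) * (k * p))"
      unfolding S_def using c0 B \<omega> \<rho> k pq by (intro bound) auto
    also have "\<dots> \<le> K * (real (N + 1) / \<delta> ^ (N + 1) * \<rho> ^ (N + 1)) * (1 + S) * exp (- (c0 / 8) * (k * p))"
      using K S \<rho> \<delta> by (intro mult_right_mono mult_mono mult_left_mono powers) auto
    also have "\<dots> = C * (\<rho> ^ (N + 1) * (1 + S) * exp (- (c0 / 8) * (k * p)))"
      by (simp add: C_def)
    finally have main: "\<bar>?M\<bar> \<le> C * (\<rho> ^ (N + 1) * (1 + S) * exp (- (c0 / 8) * (k * p)))" .
    have "\<bar>model_integrand N \<nu> lam F G k x\<bar> = q * \<bar>?M\<bar>"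
      unfolding model_integrand_def q_def[symmetric] \<rho>_def[symmetric] \<omega>_def[symmetric] p_def[symmetric]
      using pq by (simp add: abs_mult)
    also have "\<dots> \<le> q * (C * (\<rho> ^ (N + 1) * (1 + S) * exp (- (c0 / 8) * (k * p))))"
      using main pq by (intro mult_left_mono) auto
    also have "\<dots> = C * error_weight (c0 / 8) \<nu> (\<lambda>\<omega>. 1 + (\<Sum>j\<le>N. \<bar>G j \<omega>\<bar>)) (real (N + 1) + lam) k x"
    proof -
      have "real (N + 1) + lam - real DIM('a) = lam - real DIM('a) + real (N + 1)" by simp
      then have "\<rho> powr (real (N + 1) + lam - real DIM('a)) = q * \<rho> ^ (N + 1)"
        using \<rho> by (simp only: powr_add powr_realpow q_def)
      then show ?thesis
        unfolding error_weight_def \<rho>_def[symmetric] \<omega>_def[symmetric] p_def[symmetric] S_def[symmetric]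
        by (simp only: mult_ac mult_minus_left mult_minus_right)
    qed
    finally show ?thesis .
  qed
  moreover have "0 \<le> C" using K \<delta> by (simp add: C_def)
  ultimately show ?thesis by blast
qed

text \<open>
  The shift by \<open>1\<close> makes the contribution from outside a neighbourhood of the origin \<open>o(k powr (- q))\<close>.
\<close>

lemma exp_decay_le_powr:
  fixes m q :: real
  assumes m: "0 < m"
  shows "\<exists>A\<ge>0. \<forall>k\<ge>1. exp (- (m * k)) \<le> A * k powr (- q - 1)"
proof -
  obtain n :: nat where n: "q + 1 \<le> real n" using real_arch_simple by blast
  obtain A where A: "1 \<le> A" "\<And>u r. 0 \<le> u \<Longrightarrow> r \<le> n \<Longrightarrow> u ^ r \<le> A * exp (m * u)"
    using powers_le_exp[OF m, of n] by blast
  have "exp (- (m * k)) \<le> A * k powr (- q - 1)" if k: "1 \<le> k" for k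
  proof -
    have "k powr (q + 1) \<le> k powr real n" using n k by (intro powr_mono) auto
    also have "\<dots> = k ^ n" using k by (simp add: powr_realpow)
    also have "\<dots> \<le> A * exp (m * k)" using A(2)[of k n] k by simp
    finally have "k powr (q + 1) * exp (- (m * k)) \<le> A" by (simp add: exp_minus field_simps)
    moreover have "k powr (- q - 1) = 1 / k powr (q + 1)"
      using k powr_minus_divide[of k "q + 1"] by simp
    moreover have "0 < k powr (q + 1)" using k by simp
    ultimately show ?thesis
      using pos_le_divide_eq[of "k powr (q + 1)" "exp (- (m * k))" A] by (simp add: mult.commute)
  qed
  with A show ?thesis by (intro exI[of _ A]) auto
qed

section \<open>The asymptotic expansion\<close>

text \<open>
  The threshold for integrability is any \<open>k0\<close> for which the integral converges, because \<open>f \<ge> 0\<close> on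
  \<open>R\<close>.  For the expansion, \<open>\<epsilon>'\<close> is chosen so that the near region contributes less than
  \<open>\<epsilon> * k powr (- q)\<close>, where \<open>q = (N + \<lambda>) / \<nu>\<close>; the radius \<open>\<delta>\<close> is fixed afterwards, and the remaining
  contributions vanish relative to \<open>k powr (- q)\<close>.
\<close>

theorem theorem2p1:
  fixes f g :: "real ^ 'n \<Rightarrow> real"
    and R :: "(real ^ 'n) set"
    and F G :: "nat \<Rightarrow> real ^ 'n \<Rightarrow> real"
    and N :: nat
    and \<nu> lam :: real
  assumes R_meas: "R \<in> sets lebesgue"
    and R_int: "0 \<in> interior R"
    and f_meas: "f \<in> borel_measurable (lebesgue_on R)"
    and g_meas: "g \<in> borel_measurable (lebesgue_on R)"
    and f_zero: "f 0 = 0"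
    and f_pos: "\<forall>x\<in>R. x \<noteq> 0 \<longrightarrow> 0 < f x"
    and f_away: "\<forall>\<delta>>0. 0 < (INF x\<in>{x\<in>R. \<delta> \<le> norm x}. ereal (f x))"
    and N_pos: "1 \<le> N"
    and F_cont: "\<forall>j\<le>N. continuous_on (sphere 0 1) (F j)"
    and F_pos: "\<forall>\<Omega>\<in>sphere 0 1. 0 < F 0 \<Omega>"
    and nu_pos: "0 < \<nu>"
    and f_exp: "(\<lambda>(\<rho>, \<Omega>). f (\<rho> *\<^sub>R \<Omega>) - \<rho> powr \<nu> * (\<Sum>j=0..N. F j \<Omega> * \<rho> ^ j))
                  \<in> o[polar_at_0](\<lambda>(\<rho>, \<Omega>). \<rho> powr (real N + \<nu>))"
    and lam_pos: "0 < lam"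
    and g_exp: "(\<lambda>(\<rho>, \<Omega>). g (\<rho> *\<^sub>R \<Omega>)
                    - \<rho> powr (lam - real CARD('n)) * (\<Sum>j=0..N. G j \<Omega> * \<rho> ^ j))
                  \<in> o[polar_at_0](\<lambda>(\<rho>, \<Omega>). \<rho> powr (real N + lam - real CARD('n)))"
    and conv: "\<exists>k\<^sub>0>0. set_integrable lebesgue R (\<lambda>x. exp (- k\<^sub>0 * f x) * g x)"
  shows "(\<forall>\<^sub>F k in at_top. set_integrable lebesgue R (\<lambda>x. exp (- k * f x) * g x)) \<and>
         (\<forall>j\<le>N. integrable sphere_measure (zeta_integrand \<nu> lam F G j)) \<and>
         (\<lambda>k. (LINT x:R|lebesgue. exp (- k * f x) * g x)
              - (\<Sum>j=0..N. zeta_coeff \<nu> lam F G j * k powr (- ((real j + lam) / \<nu>))))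
           \<in> o[at_top](\<lambda>k. k powr (- ((real N + lam) / \<nu>)))"
proof -
  let ?S = "sphere (0::real^'n) 1"
  obtain c0 where c0: "0 < c0" "\<And>\<omega>. norm \<omega> = 1 \<Longrightarrow> c0 \<le> F 0 \<omega>"
  proof -
    have "?S \<noteq> {}" by simp
    then obtain \<omega>0 where "\<omega>0 \<in> ?S" "\<forall>\<omega>\<in>?S. F 0 \<omega>0 \<le> F 0 \<omega>"
      using continuous_attains_inf[OF compact_sphere, of 0 1 "F 0"] F_cont by blast
    with F_pos that[of "F 0 \<omega>0"] show thesis by auto
  qed
  obtain B where B: "0 \<le> B" "\<And>j \<omega>. j \<le> N \<Longrightarrow> norm \<omega> = 1 \<Longrightarrow> \<bar>F j \<omega>\<bar> \<le> B"
  proof -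
    have "continuous_on ?S (\<lambda>\<omega>. \<Sum>j\<le>N. \<bar>F j \<omega>\<bar>)" using F_cont by (intro continuous_intros) auto
    moreover have "?S \<noteq> {}" by simp
    ultimately obtain \<omega>0 where \<omega>0: "\<forall>\<omega>\<in>?S. (\<Sum>j\<le>N. \<bar>F j \<omega>\<bar>) \<le> (\<Sum>j\<le>N. \<bar>F j \<omega>0\<bar>)"
      using continuous_attains_sup[OF compact_sphere, of 0 1 "\<lambda>\<omega>. \<Sum>j\<le>N. \<bar>F j \<omega>\<bar>"] by blast
    have "\<bar>F j \<omega>\<bar> \<le> (\<Sum>j\<le>N. \<bar>F j \<omega>0\<bar>)" if "j \<le> N" "norm \<omega> = 1" for j \<omega>
    proof -
      have "\<bar>F j \<omega>\<bar> \<le> (\<Sum>j\<le>N. \<bar>F j \<omega>\<bar>)" using that by (intro member_le_sum) auto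
      with \<omega>0 that show ?thesis by force
    qed
    then show thesis by (intro that[of "\<Sum>j\<le>N. \<bar>F j \<omega>0\<bar>"]) (auto intro: sum_nonneg)
  qed
  have dim: "real DIM(real^'n) = real CARD('n)" by simp
  have f_exp': "\<exists>\<delta>>0. \<forall>\<rho> \<omega>. 0 < \<rho> \<longrightarrow> \<rho> < \<delta> \<longrightarrow> norm \<omega> = 1 \<longrightarrow>
        \<bar>f (\<rho> *\<^sub>R \<omega>) - \<rho> powr \<nu> * (\<Sum>j\<le>N. F j \<omega> * \<rho> ^ j)\<bar> \<le> c * (\<rho> powr \<nu> * \<rho> ^ N)"
    if c: "0 < c" for c
  proof -
    obtain \<delta> where "0 < \<delta>" and \<delta>: "\<And>\<rho> \<omega>. 0 < \<rho> \<and> \<rho> < \<delta> \<Longrightarrow> \<omega> \<in> ?S \<Longrightarrow>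
        \<bar>f (\<rho> *\<^sub>R \<omega>) - \<rho> powr \<nu> * (\<Sum>j=0..N. F j \<omega> * \<rho> ^ j)\<bar> \<le> c * \<bar>\<rho> powr (real N + \<nu>)\<bar>"
      using f_exp[unfolded smallo_polar_at_0_iff, rule_format, OF c] by auto
    moreover have "\<bar>\<rho> powr (real N + \<nu>)\<bar> = \<rho> powr \<nu> * \<rho> ^ N" if "0 < \<rho>" for \<rho> :: real
      using that by (simp add: powr_add powr_realpow)
    ultimately show ?thesis by (intro exI[of _ \<delta>]) (simp add: atLeast0AtMost)
  qed
  have g_exp': "\<exists>\<delta>>0. \<forall>\<rho> \<omega>. 0 < \<rho> \<longrightarrow> \<rho> < \<delta> \<longrightarrow> norm \<omega> = 1 \<longrightarrow>
        \<bar>g (\<rho> *\<^sub>R \<omega>) - \<rho> powr (lam - real DIM(real^'n)) * (\<Sum>j\<le>N. G j \<omega> * \<rho> ^ j)\<bar>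
          \<le> c * (\<rho> powr (lam - real DIM(real^'n)) * \<rho> ^ N)"
    if c: "0 < c" for c
  proof -
    obtain \<delta> where "0 < \<delta>" and \<delta>: "\<And>\<rho> \<omega>. 0 < \<rho> \<and> \<rho> < \<delta> \<Longrightarrow> \<omega> \<in> ?S \<Longrightarrow>
        \<bar>g (\<rho> *\<^sub>R \<omega>) - \<rho> powr (lam - real CARD('n)) * (\<Sum>j=0..N. G j \<omega> * \<rho> ^ j)\<bar>
          \<le> c * \<bar>\<rho> powr (real N + lam - real CARD('n))\<bar>"
      using g_exp[unfolded smallo_polar_at_0_iff, rule_format, OF c] by auto
    moreover have "\<bar>\<rho> powr (real N + lam - real CARD('n))\<bar> = \<rho> powr (lam - real CARD('n)) * \<rho> ^ N"
      if "0 < \<rho>" for \<rho> :: real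
    proof -
      have "real N + lam - real CARD('n) = (lam - real CARD('n)) + real N" by simp
      then show ?thesis using that by (simp only: powr_add powr_realpow) simp
    qed
    ultimately show ?thesis unfolding dim by (intro exI[of _ \<delta>]) (simp add: atLeast0AtMost)
  qed
  have f_nonneg: "0 \<le> f x" if "x \<in> R" for x
    using f_zero f_pos that by (cases "x = 0") (auto intro: less_imp_le)
  obtain k0 where k0: "0 < k0" and "set_integrable lebesgue R (\<lambda>x. exp (- k0 * f x) * g x)"
    using conv by blast
  define J where "J k x = indicator R x * (exp (- k * f x) * g x)" for k x
  have J0: "integrable lebesgue (J k0)"
    using \<open>set_integrable lebesgue R _\<close> by (simp add: set_integrable_def J_def[abs_def])
  have fR: "(\<lambda>x. indicator R x * f x) \<in> borel_measurable lebesgue"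
    and gR: "(\<lambda>x. indicator R x * g x) \<in> borel_measurable lebesgue"
    using f_meas g_meas R_meas by (simp_all add: borel_measurable_restrict_space_iff)
  have J_eq: "J k x = indicator R x * g x * exp (- k * (indicator R x * f x))" for k x
    by (simp add: J_def indicator_def)
  have J_meas: "J k \<in> borel_measurable lebesgue" for k
    unfolding J_eq[abs_def] using fR gR by measurable
  have J_int: "integrable lebesgue (J k)" if "k0 \<le> k" for k
  proof (rule Bochner_Integration.integrable_bound[OF J0 J_meas])
    have "norm (J k x) \<le> norm (J k0 x)" for x
    proof (cases "x \<in> R")
      case True
      have "k0 * f x \<le> k * f x" using f_nonneg[OF True] that by (intro mult_right_mono)
      with True show ?thesis by (auto simp: J_def abs_mult intro!: mult_right_mono)
    qed (simp add: J_def)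
    then show "AE x in lebesgue. norm (J k x) \<le> norm (J k0 x)" by simp
  qed
  obtain \<delta>R where \<delta>R: "0 < \<delta>R" "ball 0 \<delta>R \<subseteq> R" using R_int by (auto simp: mem_interior)
  have G_int: "integrable sphere_measure (G j)" if j: "j \<le> N" for j
  proof -
    obtain \<delta>f where \<delta>f: "0 < \<delta>f" and f1: "\<And>\<rho> \<omega>. 0 < \<rho> \<Longrightarrow> \<rho> < \<delta>f \<Longrightarrow> norm \<omega> = 1 \<Longrightarrow>
        \<bar>f (\<rho> *\<^sub>R \<omega>) - \<rho> powr \<nu> * (\<Sum>j\<le>N. F j \<omega> * \<rho> ^ j)\<bar> \<le> 1 * (\<rho> powr \<nu> * \<rho> ^ N)"
      using f_exp'[of 1] by auto
    define \<delta> where "\<delta> = min (min \<delta>R \<delta>f) 1"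
    have bound: "f x \<le> real (N + 1) * B + 1" if x: "norm x < \<delta>" for x
    proof (cases "x = 0")
      case True
      then show ?thesis using f_zero B(1) by simp
    next
      case False
      define \<rho> \<omega> where "\<rho> = norm x" and "\<omega> = unit_vector x"
      have \<rho>: "0 < \<rho>" "\<rho> < \<delta>f" "\<rho> \<le> 1" using x False by (auto simp: \<rho>_def \<delta>_def)
      have \<omega>: "norm \<omega> = 1" by (simp add: \<omega>_def)
      have x_eq: "\<rho> *\<^sub>R \<omega> = x" by (simp add: \<rho>_def \<omega>_def norm_scaleR_unit_vector)
      have p: "\<rho> powr \<nu> \<le> 1" using \<rho> nu_pos by (simp add: powr_le1)
      have "(\<Sum>j\<le>N. F j \<omega> * \<rho> ^ j) \<le> (\<Sum>j\<le>N. B * 1)"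
      proof (intro sum_mono)
        fix j assume "j \<in> {..N}"
        then have "F j \<omega> * \<rho> ^ j \<le> B * \<rho> ^ j" using B(2)[of j \<omega>] \<omega> \<rho> by (intro mult_right_mono) auto
        also have "\<dots> \<le> B * 1" using B(1) \<rho> by (intro mult_left_mono power_le_one) auto
        finally show "F j \<omega> * \<rho> ^ j \<le> B * 1" .
      qed
      then have "(\<Sum>j\<le>N. F j \<omega> * \<rho> ^ j) \<le> real (N + 1) * B" by simp
      then have "\<rho> powr \<nu> * (\<Sum>j\<le>N. F j \<omega> * \<rho> ^ j) \<le> \<rho> powr \<nu> * (real (N + 1) * B)"
        by (intro mult_left_mono) auto
      also have "\<dots> \<le> 1 * (real (N + 1) * B)" using p B(1) by (intro mult_right_mono) auto
      finally have "\<rho> powr \<nu> * (\<Sum>j\<le>N. F j \<omega> * \<rho> ^ j) \<le> real (N + 1) * B" by simp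
      moreover have "\<rho> powr \<nu> * \<rho> ^ N \<le> 1 * 1" using p \<rho> by (intro mult_mono power_le_one) auto
      ultimately show ?thesis using f1[OF \<rho>(1,2) \<omega>] unfolding x_eq by linarith
    qed
    show ?thesis
    proof (rule integrable_coefficients_of_factor[OF _ k0 _ _ bound gR g_exp' j])
      show "integrable lebesgue (\<lambda>x. indicator R x * (exp (- k0 * f x) * g x))"
        using J0 by (simp add: J_def[abs_def])
      show "ball 0 \<delta> \<subseteq> R" using \<delta>R by (auto simp: \<delta>_def)
      show "0 < \<delta>" using \<delta>R \<delta>f by (simp add: \<delta>_def)
    qed
  qed
  define H where "H \<omega> = 1 + (\<Sum>j\<le>N. \<bar>G j \<omega>\<bar>)" for \<omega>
  have H_int: "integrable sphere_measure H"
  proof -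
    interpret finite_measure "sphere_borel_measure :: (real^'n) measure"
      by (rule finite_measure_sphere_borel_measure)
    have "integrable (sphere_measure :: (real^'n) measure) (\<lambda>\<omega>. 1 :: real)"
      unfolding sphere_measure_eq_completion by (subst integrable_completion) auto
    then show ?thesis unfolding H_def[abs_def] using G_int
      by (intro Bochner_Integration.integrable_add Bochner_Integration.integrable_sum integrable_abs) auto
  qed
  have F_cont': "\<And>j. j \<le> N \<Longrightarrow> continuous_on ?S (F j)" using F_cont by blast
  define Z where "Z k = (\<Sum>j\<le>N. zeta_coeff \<nu> lam F G j * k powr (- ((real j + lam) / \<nu>)))" for k
  have model: "has_bochner_integral lebesgue (model_integrand N \<nu> lam F G k) (Z k)" if "0 < k" for k
    unfolding Z_def model_integrand_def[abs_def]
    using has_bochner_integral_laplace_model(1)[where F = F and G = G and c = c0, OF F_cont' c0(2,1) G_int lam_pos nu_pos that] .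
  have zeta_int: "\<forall>j\<le>N. integrable sphere_measure (zeta_integrand \<nu> lam F G j)"
    using has_bochner_integral_laplace_model(2)[where F = F and G = G and c = c0, OF F_cont' c0(2,1) G_int lam_pos nu_pos zero_less_one] by blast
  define \<kappa> where "\<kappa> = c0 / 8"
  define W where "W a = 1 / \<nu> * Gamma (a / \<nu>) * (\<integral>\<omega>. \<kappa> powr (- (a / \<nu>)) * H \<omega> \<partial>sphere_measure)" for a
  have weight: "has_bochner_integral lebesgue (error_weight \<kappa> \<nu> H a k) (W a * k powr (- (a / \<nu>)))"
    if "0 < a" "0 < k" for a k
    unfolding W_def using c0 by (intro has_bochner_integral_error_weight[OF H_int _ that(1) nu_pos that(2)]) (simp add: \<kappa>_def)
  have weight_nonneg: "0 \<le> error_weight \<kappa> \<nu> H a k x" for a k x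
    by (simp add: error_weight_def H_def sum_nonneg add_nonneg_nonneg)
  define q where "q = (real N + lam) / \<nu>"
  define a1 where "a1 = real (N + 1) + lam"
  have aN: "0 < real N + lam" "0 < a1" using lam_pos by (auto simp: a1_def)
  have asymp: "(\<lambda>k. integral\<^sup>L lebesgue (J k) - Z k) \<in> o[at_top](\<lambda>k. k powr (- q))"
  proof (rule landau_o.smallI)
    fix \<epsilon> :: real assume \<epsilon>: "0 < \<epsilon>"
    define V where "V = \<bar>W (real N + lam)\<bar> + 1"
    have V: "0 < V" "W (real N + lam) \<le> V" by (auto simp: V_def)
    define \<epsilon>' where "\<epsilon>' = \<epsilon> / (2 * V)"
    have \<epsilon>': "0 < \<epsilon>'" using \<epsilon> V by (simp add: \<epsilon>'_def)
    have "\<epsilon>' * W (real N + lam) \<le> \<epsilon>' * V" using \<epsilon>' V by (intro mult_left_mono) auto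
    also have "\<dots> = \<epsilon> / 2" using V by (simp add: \<epsilon>'_def)
    finally have \<epsilon>'W: "\<epsilon>' * W (real N + lam) < \<epsilon>" using \<epsilon> by linarith
    obtain \<delta>n where \<delta>n: "0 < \<delta>n" and near: "\<And>k x. 0 < k \<Longrightarrow> x \<noteq> 0 \<Longrightarrow> norm x < \<delta>n \<Longrightarrow>
        \<bar>exp (- k * f x) * g x - model_integrand N \<nu> lam F G k x\<bar> \<le> \<epsilon>' * error_weight \<kappa> \<nu> H (real N + lam) k x"
      using integrand_minus_model_near_0[where F = F and G = G, OF c0 B f_exp' g_exp' \<epsilon>'] unfolding \<kappa>_def H_def[abs_def] by blast
    define \<delta> where "\<delta> = min (min \<delta>R \<delta>n) 1"
    have \<delta>: "0 < \<delta>" "\<delta> \<le> 1" "\<delta> \<le> \<delta>R" "\<delta> \<le> \<delta>n" using \<delta>R \<delta>n by (auto simp: \<delta>_def)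
    obtain C where C: "0 \<le> C" and far: "\<And>k x. 0 < k \<Longrightarrow> \<delta> \<le> norm x \<Longrightarrow>
        \<bar>model_integrand N \<nu> lam F G k x\<bar> \<le> C * error_weight \<kappa> \<nu> H a1 k x"
      using model_integrand_away_from_0[where F = F and G = G, OF c0 B(2) \<delta>(1,2)] unfolding \<kappa>_def H_def[abs_def] a1_def by blast
    \<comment> \<open>The infimum may be \<open>\<infinity>\<close> (when \<open>R\<close> is contained in the ball), so a real number below it is taken.\<close>
    obtain m where m: "0 < m" "\<And>x. x \<in> R \<Longrightarrow> \<delta> \<le> norm x \<Longrightarrow> m \<le> f x"
    proof -
      have "ereal 0 < (INF x\<in>{x\<in>R. \<delta> \<le> norm x}. ereal (f x))"
        using f_away \<delta>(1) by (simp add: zero_ereal_def)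
      then obtain m where m: "ereal 0 < ereal m" "ereal m < (INF x\<in>{x\<in>R. \<delta> \<le> norm x}. ereal (f x))"
        using ereal_dense2 by blast
      have "m \<le> f x" if "x \<in> R" "\<delta> \<le> norm x" for x
      proof -
        have "(INF x\<in>{x\<in>R. \<delta> \<le> norm x}. ereal (f x)) \<le> ereal (f x)"
          by (rule INF_lower) (simp add: that)
        with m(2) have "ereal m \<le> ereal (f x)" by order
        then show ?thesis by simp
      qed
      with m(1) show thesis by (intro that[of m]) auto
    qed
    obtain A where A: "0 \<le> A" "\<And>k. 1 \<le> k \<Longrightarrow> exp (- (m * k)) \<le> A * k powr (- q - 1)"
      using exp_decay_le_powr[OF m(1), of q] by blast
    define D where "D = exp (k0 * m) * A * (\<integral>x. \<bar>J k0 x\<bar> \<partial>lebesgue)"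
    have pointwise: "\<bar>J k x - model_integrand N \<nu> lam F G k x\<bar>
        \<le> \<epsilon>' * error_weight \<kappa> \<nu> H (real N + lam) k x + C * error_weight \<kappa> \<nu> H a1 k x
          + exp (- ((k - k0) * m)) * \<bar>J k0 x\<bar>"
      if k: "k0 \<le> k" and x: "x \<noteq> 0" for k x
    proof (cases "norm x < \<delta>")
      case True
      then have "x \<in> R" using \<delta>R(2) \<delta>(3) by auto
      have "\<bar>J k x - model_integrand N \<nu> lam F G k x\<bar> \<le> \<epsilon>' * error_weight \<kappa> \<nu> H (real N + lam) k x"
        using near[of k x] k k0 x True \<delta>(4) \<open>x \<in> R\<close> by (simp add: J_def)
      moreover have "0 \<le> C * error_weight \<kappa> \<nu> H a1 k x" using C weight_nonneg by simp
      moreover have "0 \<le> exp (- ((k - k0) * m)) * \<bar>J k0 x\<bar>" by simp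
      ultimately show ?thesis by linarith
    next
      case False
      have "\<bar>J k x\<bar> \<le> exp (- ((k - k0) * m)) * \<bar>J k0 x\<bar>"
      proof (cases "x \<in> R")
        case True
        have "(k - k0) * m \<le> (k - k0) * f x" using m(2)[OF True] False k by (intro mult_left_mono) auto
        then have "exp (- k * f x) \<le> exp (- ((k - k0) * m)) * exp (- k0 * f x)"
          unfolding exp_add[symmetric] by (simp add: algebra_simps)
        then have "exp (- k * f x) * \<bar>g x\<bar> \<le> exp (- ((k - k0) * m)) * exp (- k0 * f x) * \<bar>g x\<bar>"
          by (intro mult_right_mono) auto
        with True show ?thesis by (simp add: J_def abs_mult)
      qed (simp add: J_def)
      moreover have "\<bar>model_integrand N \<nu> lam F G k x\<bar> \<le> C * error_weight \<kappa> \<nu> H a1 k x"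
        using far[of k x] k k0 False by simp
      moreover have "0 \<le> \<epsilon>' * error_weight \<kappa> \<nu> H (real N + lam) k x" using \<epsilon>' weight_nonneg by simp
      ultimately show ?thesis by linarith
    qed
    have bound: "\<bar>integral\<^sup>L lebesgue (J k) - Z k\<bar>
        \<le> (\<epsilon>' * W (real N + lam) + C * W a1 * k powr (- (1 / \<nu>)) + D * k powr (- 1)) * k powr (- q)"
      if k: "k0 \<le> k" "1 \<le> k" for k
    proof -
      have k': "0 < k" using k by simp
      have w0: "integrable lebesgue (error_weight \<kappa> \<nu> H (real N + lam) k)"
        "integral\<^sup>L lebesgue (error_weight \<kappa> \<nu> H (real N + lam) k) = W (real N + lam) * k powr (- q)"
        using weight[OF aN(1) k'] by (simp_all add: has_bochner_integral_iff q_def)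
      have w1: "integrable lebesgue (error_weight \<kappa> \<nu> H a1 k)"
        "integral\<^sup>L lebesgue (error_weight \<kappa> \<nu> H a1 k) = W a1 * k powr (- (a1 / \<nu>))"
        using weight[OF aN(2) k'] by (simp_all add: has_bochner_integral_iff)
      have M: "integrable lebesgue (model_integrand N \<nu> lam F G k)"
        "integral\<^sup>L lebesgue (model_integrand N \<nu> lam F G k) = Z k"
        using model[OF k'] by (simp_all add: has_bochner_integral_iff)
      note ints = J_int[OF k(1)] w0(1) w1(1) M(1) J0
      have "\<bar>integral\<^sup>L lebesgue (J k) - Z k\<bar> = \<bar>\<integral>x. J k x - model_integrand N \<nu> lam F G k x \<partial>lebesgue\<bar>"
        using ints by (simp add: M(2))
      also have "\<dots> \<le> (\<integral>x. \<bar>J k x - model_integrand N \<nu> lam F G k x\<bar> \<partial>lebesgue)"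
        by (rule integral_abs_bound)
      also have "\<dots> \<le> (\<integral>x. \<epsilon>' * error_weight \<kappa> \<nu> H (real N + lam) k x + C * error_weight \<kappa> \<nu> H a1 k x
          + exp (- ((k - k0) * m)) * \<bar>J k0 x\<bar> \<partial>lebesgue)"
      proof (rule integral_mono_AE)
        have "AE x in lebesgue. x \<noteq> (0::real^'n)" by (rule AE_completion) (rule AE_lborel_singleton)
        then show "AE x in lebesgue. \<bar>J k x - model_integrand N \<nu> lam F G k x\<bar>
            \<le> \<epsilon>' * error_weight \<kappa> \<nu> H (real N + lam) k x + C * error_weight \<kappa> \<nu> H a1 k x
              + exp (- ((k - k0) * m)) * \<bar>J k0 x\<bar>"
          by eventually_elim (rule pointwise[OF k(1)])
      qed (use ints in auto)
      also have "\<dots> = \<epsilon>' * (W (real N + lam) * k powr (- q)) + C * (W a1 * k powr (- (a1 / \<nu>)))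
          + exp (- ((k - k0) * m)) * (\<integral>x. \<bar>J k0 x\<bar> \<partial>lebesgue)"
        using ints by (simp add: w0(2) w1(2))
      also have "k powr (- (a1 / \<nu>)) = k powr (- (1 / \<nu>)) * k powr (- q)"
        unfolding powr_add[symmetric] by (rule arg_cong) (simp add: a1_def q_def add_divide_distrib)
      also have "exp (- ((k - k0) * m)) * (\<integral>x. \<bar>J k0 x\<bar> \<partial>lebesgue) \<le> D * k powr (- 1) * k powr (- q)"
      proof -
        have "exp (- ((k - k0) * m)) = exp (k0 * m) * exp (- (m * k))"
          unfolding exp_add[symmetric] by (simp add: algebra_simps)
        also have "\<dots> \<le> exp (k0 * m) * (A * k powr (- q - 1))"
          using A(2)[OF k(2)] by (intro mult_left_mono) auto
        also have "k powr (- q - 1) = k powr (- 1) * k powr (- q)"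
          unfolding powr_add[symmetric] by (rule arg_cong) simp
        finally have "exp (- ((k - k0) * m)) \<le> exp (k0 * m) * (A * (k powr (- 1) * k powr (- q)))" .
        then have "exp (- ((k - k0) * m)) * (\<integral>x. \<bar>J k0 x\<bar> \<partial>lebesgue)
            \<le> exp (k0 * m) * (A * (k powr (- 1) * k powr (- q))) * (\<integral>x. \<bar>J k0 x\<bar> \<partial>lebesgue)"
          by (intro mult_right_mono) auto
        then show ?thesis by (simp only: D_def mult_ac)
      qed
      finally show ?thesis by (simp add: algebra_simps)
    qed
    have "((\<lambda>k. \<epsilon>' * W (real N + lam) + C * W a1 * k powr (- (1 / \<nu>)) + D * k powr (- 1))
        \<longlongrightarrow> \<epsilon>' * W (real N + lam) + C * W a1 * 0 + D * 0) at_top"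
      using nu_pos by (intro tendsto_intros tendsto_neg_powr filterlim_ident) auto
    then have "\<forall>\<^sub>F k in at_top. \<epsilon>' * W (real N + lam) + C * W a1 * k powr (- (1 / \<nu>)) + D * k powr (- 1) < \<epsilon>"
      using \<epsilon>'W by (intro order_tendstoD(2)) auto
    then show "\<forall>\<^sub>F k in at_top. norm (integral\<^sup>L lebesgue (J k) - Z k) \<le> \<epsilon> * norm (k powr (- q))"
      using eventually_ge_at_top[of k0] eventually_ge_at_top[of 1]
    proof eventually_elim
      case (elim k)
      have "(\<epsilon>' * W (real N + lam) + C * W a1 * k powr (- (1 / \<nu>)) + D * k powr (- 1)) * k powr (- q)
          \<le> \<epsilon> * k powr (- q)"
        using elim(1) by (intro mult_right_mono) auto
      with bound[OF elim(2,3)] show ?case by simp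
    qed
  qed
  have "\<forall>\<^sub>F k in at_top. set_integrable lebesgue R (\<lambda>x. exp (- k * f x) * g x)"
    using eventually_ge_at_top[of k0]
    by eventually_elim (use J_int in \<open>simp add: set_integrable_def J_def[abs_def]\<close>)
  moreover have "(LINT x:R|lebesgue. exp (- k * f x) * g x) = integral\<^sup>L lebesgue (J k)" for k
    by (simp add: set_lebesgue_integral_def J_def[abs_def])
  ultimately show ?thesis
    using zeta_int asymp by (simp only: Z_def q_def atLeast0AtMost)
qed

end
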